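(* Let $\alpha,\beta>0$ and $\bar x\in\mathbb{R}^n$. Suppose that $(\bar y,\bar p)=S_{\alpha,\beta}(\bar x)$ and that the relative interior condition $G(\bar x,\bar y)-\alpha\bar p\in \operatorname{ri}(\partial h^*(\bar p))$ is satisfied. Then $S_{\alpha,\beta}$ is $C^1$ in a neighborhood of $\bar x$. Moreover, $$\nabla S_{\alpha,\beta}(\bar x)=-B(B^\top AB)^{-1}B^\top\begin{pmatrix}\nabla_x\nabla_y L_{\alpha,\beta}(\bar x,\bar y,\bar p)\\ \nabla_x G(\bar x,\bar y)\end{pmatrix},$$ where $$A=\begin{pmatrix}\nabla^2_{yy}L_{\alpha,\beta}(\bar x,\bar y,\bar p) & \nabla_yG(\bar x,\bar y)^\top\\ \nabla_yG(\bar x,\bar y) & -\alpha I_s\end{pmatrix}$$ and $B$ is a matrix whose columns form a basis of $\mathbb{R}^m\times K_{h^*}(\bar p,\,G(\bar x,\bar y)-\alpha\bar p)$.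
   Context: Standing assumptions: $g:\mathbb{R}^n\times\mathbb{R}^m\to\mathbb{R}$ and $G=(g_1,\dots,g_s):\mathbb{R}^n\times\mathbb{R}^m\to\mathbb{R}^s$ are $C^2$; for every $x\in\mathbb{R}^n$, $g(x,\cdot)$ and each $g_i(x,\cdot)$ are convex; $h:\mathbb{R}^s\to[-\infty,\infty]$ is proper, epi-polyhedral (its epigraph is a polyhedral set) and nondecreasing ($z\ge z'$ componentwise implies $h(z)\ge h(z')$). $h^*$ is the convex conjugate of $h$, $\partial h^*$ its subdifferential, and $\operatorname{ri}$ denotes relative interior. For $\alpha,\beta>0$, $S_{\alpha,\beta}(x)$ is the set of $(y,p)\in\mathbb{R}^m\times\mathbb{R}^s$ with $$0=-\nabla_yg(x,y)-\nabla_yG(x,y)^\top p-\beta y,\qquad 0\in -G(x,y)+\alpha p+\partial h^*(p).$$ This set is a singleton for every $x$, so $S_{\alpha,\beta}$ is treated as a function $\mathbb{R}^n\to\mathbb{R}^m\times\mathbb{R}^s$. The Lagrangian is $L_{\alpha,\beta}(x,y,p)=g(x,y)+\frac{\beta}{2}|y|^2+\langle G(x,y),p\rangle-h^*(p)-\frac{\alpha}{2}|p|^2$. The critical cone of $h^*$ at $p$ for $u\in\partial h^*(p)$ is $K_{h^*}(p,u)=N_{\partial h^*(p)}(u)$, the normal cone to the convex set $\partial h^*(p)$ at $u$ (a linear subspace when $u\in\operatorname{ri}\partial h^*(p)$). $\nabla_yG$ ($s\times m$), $\nabla_xG$ ($s\times n$), $\nabla_x\nabla_yL_{\alpha,\beta}$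 ($m\times n$, the Jacobian in $x$ of $\nabla_yL_{\alpha,\beta}$) and $\nabla S_{\alpha,\beta}$ ($(m+s)\times n$) are Jacobians; $I_s$ is the identity matrix. *)

theory Defs
  imports "HOL-Analysis.Analysis"
begin

section \<open>Smoothness\<close>

definition C1_on :: "'a::real_normed_vector set \<Rightarrow> ('a \<Rightarrow> 'b::real_normed_vector) \<Rightarrow> bool" where
  "C1_on U f \<longleftrightarrow>
     (\<exists>f' :: 'a \<Rightarrow> 'a \<Rightarrow>\<^sub>L 'b.
        (\<forall>x\<in>U. (f has_derivative blinfun_apply (f' x)) (at x)) \<and> continuous_on U f')"

definition C2 :: "('a::real_normed_vector \<Rightarrow> 'b::real_normed_vector) \<Rightarrow> bool" where
  "C2 f \<longleftrightarrow>
     (\<exists>f' :: 'a \<Rightarrow> 'a \<Rightarrow>\<^sub>L 'b.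
        (\<forall>x. (f has_derivative blinfun_apply (f' x)) (at x)) \<and> C1_on UNIV f')"

text \<open>Unspecified where \<open>f\<close> is not differentiable, like \<^const>\<open>frechet_derivative\<close>.\<close>

definition gradient :: "('a::real_inner \<Rightarrow> real) \<Rightarrow> 'a \<Rightarrow> 'a" where
  "gradient f x = (THE D. GDERIV f x :> D)"


section \<open>Extended-real convex analysis\<close>

definition proper :: "('a \<Rightarrow> ereal) \<Rightarrow> bool" where
  "proper f \<longleftrightarrow> (\<forall>z. f z \<noteq> -\<infinity>) \<and> (\<exists>z. f z \<noteq> \<infinity>)"

definition epi_polyhedral :: "('a::euclidean_space \<Rightarrow> ereal) \<Rightarrow> bool" where
  "epi_polyhedral f \<longleftrightarrow> polyhedron {(z, t). f z \<le> ereal t}"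

definition conjugate :: "('a::real_inner \<Rightarrow> ereal) \<Rightarrow> 'a \<Rightarrow> ereal" where
  "conjugate f p = (SUP z. ereal (z \<bullet> p) - f z)"

text \<open>The subdifferential is empty at points where the function is not finite.\<close>

definition subdifferential :: "('a::real_inner \<Rightarrow> ereal) \<Rightarrow> 'a \<Rightarrow> 'a set" where
  "subdifferential f p =
     {u. \<bar>f p\<bar> \<noteq> \<infinity> \<and> (\<forall>q. f p + ereal (u \<bullet> (q - p)) \<le> f q)}"

definition normal_cone :: "'a::real_inner set \<Rightarrow> 'a \<Rightarrow> 'a set" where
  "normal_cone C u = {v. u \<in> C \<and> (\<forall>w\<in>C. v \<bullet> (w - u) \<le> 0)}"

definition critical_cone :: "('a::real_inner \<Rightarrow> ereal) \<Rightarrow> 'a \<Rightarrow> 'a \<Rightarrow> 'a set" where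
  "critical_cone f p u = normal_cone (subdifferential f p) u"


section \<open>Block vectors and matrices\<close>

text \<open>
  Coordinates of \<open>\<real>\<^sup>m \<times> \<real>\<^sup>s\<close> are indexed by the sum type \<open>'m + 's\<close>. As a matrix is the
  vector of its rows, \<open>vstack\<close> stacks vectors as well as matrices.
\<close>

definition vstack :: "'a ^ 'm \<Rightarrow> 'a ^ 's \<Rightarrow> 'a ^ ('m + 's)" where
  "vstack u v = (\<chi> i. case i of Inl a \<Rightarrow> u $ a | Inr b \<Rightarrow> v $ b)"

definition hstack :: "'a ^ 'm ^ 'k \<Rightarrow> 'a ^ 's ^ 'k \<Rightarrow> 'a ^ ('m + 's) ^ 'k" where
  "hstack M N = (\<chi> i. vstack (M $ i) (N $ i))"

text \<open>
  Injectivity excludes repeated columns, which the set \<^term>\<open>columns B\<close> does not see.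
\<close>

definition columns_form_basis :: "real ^ 'k ^ 'd \<Rightarrow> (real ^ 'd) set \<Rightarrow> bool" where
  "columns_form_basis B V \<longleftrightarrow>
     inj (\<lambda>j. column j B) \<and> independent (columns B) \<and> span (columns B) = V"


section \<open>The regularized primal-dual system\<close>

definition sol_set ::
  "((real ^ 'n) \<times> (real ^ 'm) \<Rightarrow> real) \<Rightarrow> ((real ^ 'n) \<times> (real ^ 'm) \<Rightarrow> real ^ 's) \<Rightarrow>
   (real ^ 's \<Rightarrow> ereal) \<Rightarrow> real \<Rightarrow> real \<Rightarrow> real ^ 'n \<Rightarrow> ((real ^ 'm) \<times> (real ^ 's)) set" where
  "sol_set g G h \<alpha> \<beta> x =
     {(y, p).
        0 = - gradient (\<lambda>y. g (x, y)) y
            - transpose (jacobian (\<lambda>y. G (x, y)) (at y)) *v p - \<beta> *\<^sub>R y \<and>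
        0 \<in> (\<lambda>u. - G (x, y) + \<alpha> *\<^sub>R p + u) ` subdifferential (conjugate h) p}"

definition sol_map ::
  "((real ^ 'n) \<times> (real ^ 'm) \<Rightarrow> real) \<Rightarrow> ((real ^ 'n) \<times> (real ^ 'm) \<Rightarrow> real ^ 's) \<Rightarrow>
   (real ^ 's \<Rightarrow> ereal) \<Rightarrow> real \<Rightarrow> real \<Rightarrow> real ^ 'n \<Rightarrow> (real ^ 'm) \<times> (real ^ 's)" where
  "sol_map g G h \<alpha> \<beta> x = (THE yp. yp \<in> sol_set g G h \<alpha> \<beta> x)"

definition lagrangian ::
  "((real ^ 'n) \<times> (real ^ 'm) \<Rightarrow> real) \<Rightarrow> ((real ^ 'n) \<times> (real ^ 'm) \<Rightarrow> real ^ 's) \<Rightarrow>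
   (real ^ 's \<Rightarrow> ereal) \<Rightarrow> real \<Rightarrow> real \<Rightarrow> real ^ 'n \<Rightarrow> real ^ 'm \<Rightarrow> real ^ 's \<Rightarrow> ereal" where
  "lagrangian g G h \<alpha> \<beta> x y p =
     ereal (g (x, y) + \<beta> / 2 * (norm y)\<^sup>2 + G (x, y) \<bullet> p) - conjugate h p
       - ereal (\<alpha> / 2 * (norm p)\<^sup>2)"

text \<open>
  For \<open>p\<close> with \<^term>\<open>conjugate h p\<close> finite, in particular whenever
  \<^term>\<open>subdifferential (conjugate h) p\<close> is nonempty, the Lagrangian is finite in all
  \<open>(x, y)\<close>, so \<^const>\<open>real_of_ereal\<close> only changes its type before differentiation.
\<close>

definition grad_y_lagrangian ::
  "((real ^ 'n) \<times> (real ^ 'm) \<Rightarrow> real) \<Rightarrow> ((real ^ 'n) \<times> (real ^ 'm) \<Rightarrow> real ^ 's) \<Rightarrow>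
   (real ^ 's \<Rightarrow> ereal) \<Rightarrow> real \<Rightarrow> real \<Rightarrow> real ^ 'n \<Rightarrow> real ^ 'm \<Rightarrow> real ^ 's \<Rightarrow> real ^ 'm" where
  "grad_y_lagrangian g G h \<alpha> \<beta> x y p =
     gradient (\<lambda>y. real_of_ereal (lagrangian g G h \<alpha> \<beta> x y p)) y"

definition matrix_A ::
  "((real ^ 'n) \<times> (real ^ 'm) \<Rightarrow> real) \<Rightarrow> ((real ^ 'n) \<times> (real ^ 'm) \<Rightarrow> real ^ 's) \<Rightarrow>
   (real ^ 's \<Rightarrow> ereal) \<Rightarrow> real \<Rightarrow> real \<Rightarrow> real ^ 'n \<Rightarrow> real ^ 'm \<Rightarrow> real ^ 's \<Rightarrow>
   real ^ ('m + 's) ^ ('m + 's)" where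
  "matrix_A g G h \<alpha> \<beta> x y p =
     (let JG = jacobian (\<lambda>y. G (x, y)) (at y) in
      vstack (hstack (jacobian (\<lambda>y. grad_y_lagrangian g G h \<alpha> \<beta> x y p) (at y)) (transpose JG))
             (hstack JG (- (\<alpha> *\<^sub>R mat 1))))"

definition x_derivatives ::
  "((real ^ 'n) \<times> (real ^ 'm) \<Rightarrow> real) \<Rightarrow> ((real ^ 'n) \<times> (real ^ 'm) \<Rightarrow> real ^ 's) \<Rightarrow>
   (real ^ 's \<Rightarrow> ereal) \<Rightarrow> real \<Rightarrow> real \<Rightarrow> real ^ 'n \<Rightarrow> real ^ 'm \<Rightarrow> real ^ 's \<Rightarrow>
   real ^ 'n ^ ('m + 's)" where
  "x_derivatives g G h \<alpha> \<beta> x y p =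
     vstack (jacobian (\<lambda>x. grad_y_lagrangian g G h \<alpha> \<beta> x y p) (at x))
            (jacobian (\<lambda>x. G (x, y)) (at x))"

end

theory Submission
  imports Defs
begin

text \<open>
  Polyhedrality of \<open>h\<close> and the relative interior condition make the graph of \<open>\<partial>h\<^sup>*\<close> coincide, near
  \<open>(pbar, ubar)\<close> with \<open>ubar = G (xbar, ybar) - \<alpha> pbar\<close>, with the affine set
  \<open>(pbar + K) \<times> (ubar + K\<^sup>\<bottom>)\<close>, where \<open>K\<close> is the critical cone. The system defining the solution
  map thereby becomes a square system of \<open>C\<^sup>1\<close> equations. Its linearisation in \<open>(y, p)\<close> is
  injective: the derivative in \<open>y\<close> of the gradient of the Lagrangian is bounded below by \<open>\<beta>\<close>, and
  the block \<open>-\<alpha> I\<close> is negative definite. The implicit function theorem yields a \<open>C\<^sup>1\<close> branch of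
  solutions, which is the solution map because solutions are unique.
\<close>


section \<open>Conjugates and polyhedral epigraphs\<close>

text \<open>Of the local identity only one inclusion is proved: the affine set lies in the graph.
  Zeros of the affine system near the reference point are therefore solutions, and global uniqueness
  excludes any others. Uniqueness and the lower bound \<beta> both need
  \<open>G (x, y) \<bullet> p\<close> to be convex in \<open>y\<close>, hence
  \<open>p \<ge> 0\<close>, which the monotonicity of \<open>h\<close> supplies. Polyhedrality
  enters through the cone of feasible directions of the epigraph: this cone is closed, so the strict
  growth of \<open>h\<close> across \<open>K\<close> has a uniform rate, and \<open>pbar\<close> may
  be tilted by that much. The equations are as many as the unknowns because \<open>K\<close> and its
  orthogonal complement have complementary dimensions. Since \<open>sol_map\<close> is a definite
  description, the hypothesis on \<open>(ybar, pbar)\<close> says something only once a solution at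
  \<open>xbar\<close> is known to exist; existence is obtained by minimisation. One injectivity
  computation serves both the implicit function theorem and the invertibility of the reduced
  matrix.\<close>

lemma conjugate_le_iff:
  fixes h :: "'a::real_inner \<Rightarrow> ereal"
  assumes "proper h"
  shows "conjugate h p \<le> ereal r \<longleftrightarrow> (\<forall>z t. h z \<le> ereal t \<longrightarrow> z \<bullet> p - t \<le> r)"
proof -
  have "ereal (z \<bullet> p) - h z \<le> ereal r \<longleftrightarrow> (\<forall>t. h z \<le> ereal t \<longrightarrow> z \<bullet> p - t \<le> r)" for z
  proof (cases "h z")
    case (real s)
    then show ?thesis
      by (auto simp: algebra_simps)
  qed (use assms in \<open>auto simp: proper_def\<close>)
  then show ?thesis
    unfolding conjugate_def SUP_le_iff by blast
qed

text \<open>Quantifying over the epigraph, as in \<open>conjugate_le_iff\<close>, leaves only real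
  arithmetic even where \<open>h z\<close> is infinite.\<close>

lemma mem_subdifferential_iff:
  assumes "h u = ereal r"
  shows "p \<in> subdifferential h u \<longleftrightarrow> (\<forall>z t. h z \<le> ereal t \<longrightarrow> r + p \<bullet> (z - u) \<le> t)"
proof -
  have "ereal r + ereal (p \<bullet> (z - u)) \<le> h z \<longleftrightarrow>
        (\<forall>t. h z \<le> ereal t \<longrightarrow> r + p \<bullet> (z - u) \<le> t)" for z
  proof (cases "h z")
    case MInf
    then show ?thesis
      by (auto intro!: exI[of _ "r + p \<bullet> (z - u) - 1"])
  next
    case (real s)
    then show ?thesis by auto
  qed auto
  then show ?thesis
    unfolding subdifferential_def using assms by auto
qed

text \<open>Fenchel equality: the subgradient inequality says that
  \<open>z \<bullet> p - h z\<close> is largest at \<open>z = u\<close>, so the affine minorant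
  \<open>q \<mapsto> u \<bullet> q - h u\<close> of the conjugate is exact at
  \<open>p\<close>.\<close>

lemma subdifferential_conjugateI:
  assumes p: "p \<in> subdifferential h u"
  shows "u \<in> subdifferential (conjugate h) p"
proof -
  obtain r where r: "h u = ereal r"
    using p by (cases "h u") (auto simp: subdifferential_def)
  have sub: "ereal (r + p \<bullet> (z - u)) \<le> h z" for z
    using p r by (auto simp: subdifferential_def)
  have lower: "ereal (u \<bullet> q - r) \<le> conjugate h q" for q
    unfolding conjugate_def using r by (intro SUP_upper2[of u]) auto
  have "conjugate h p \<le> ereal (u \<bullet> p - r)"
    unfolding conjugate_def
  proof (rule SUP_least)
    fix z
    show "ereal (z \<bullet> p) - h z \<le> ereal (u \<bullet> p - r)"
      using sub[of z] by (cases "h z") (auto simp: algebra_simps inner_commute)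
  qed
  with lower have eq: "conjugate h p = ereal (u \<bullet> p - r)"
    by (simp add: antisym)
  have "conjugate h p + ereal (u \<bullet> (q - p)) \<le> conjugate h q" for q
    using lower[of q] unfolding eq by (simp add: algebra_simps)
  then show ?thesis
    by (simp add: subdifferential_def eq)
qed

text \<open>The epigraph contains upward rays, which forces \<open>b \<ge> 0\<close>. A vertical
  hyperplane, \<open>b = 0\<close>, remains possible and has to be handled by the caller.\<close>

lemma epigraph_separation:
  fixes h :: "'a::euclidean_space \<Rightarrow> ereal"
  assumes "proper h" "closed {(z, t). h z \<le> ereal t}" "convex {(z, t). h z \<le> ereal t}"
    and s: "\<not> h u \<le> ereal s"
  obtains a b k where "a \<bullet> u + b * s < k" "b \<ge> 0" "\<forall>z t. h z \<le> ereal t \<longrightarrow> k < a \<bullet> z + b * t"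
proof -
  let ?E = "{(z, t). h z \<le> ereal t}"
  have "(u, s) \<notin> ?E"
    using s by simp
  from separating_hyperplane_closed_point[OF assms(3,2) this]
  obtain c k where c: "c \<bullet> (u, s) < k" "\<And>x. x \<in> ?E \<Longrightarrow> c \<bullet> x > k"
    by blast
  obtain a b where ab: "c = (a, b)" by (cases c)
  have sep: "k < a \<bullet> z + b * t" if "h z \<le> ereal t" for z t
    using c(2)[of "(z, t)"] that by (simp add: ab)
  have "b \<ge> 0"
  proof (rule ccontr)
    assume "\<not> b \<ge> 0"
    then have b: "b < 0" by simp
    obtain z0 t0 where zt: "h z0 = ereal t0"
      using assms(1) unfolding proper_def by (metis real_of_ereal.cases)
    \<comment> \<open>High enough above \<open>z0\<close>, a negative \<open>b\<close> pushes the
      functional down to \<open>k\<close> or below.\<close>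
    define t1 where "t1 = max t0 ((k - a \<bullet> z0) / b)"
    have "k < a \<bullet> z0 + b * t1"
      by (rule sep) (simp add: zt t1_def)
    moreover have "b * t1 \<le> b * ((k - a \<bullet> z0) / b)"
      using b by (intro mult_left_mono_neg) (auto simp: t1_def)
    ultimately show False
      using b by simp
  qed
  then show thesis
    using that c(1) sep by (simp add: ab)
qed

text \<open>The hard half of conjugate duality. If \<open>h u\<close> exceeded
  \<open>u \<bullet> p - conjugate h p\<close>, a hyperplane separating the lower point from the
  epigraph would produce a slope at which the conjugate is too small for the subgradient
  \<open>u\<close>.\<close>

lemma subdifferential_conjugateD:
  fixes h :: "'a::euclidean_space \<Rightarrow> ereal"
  assumes h: "proper h" "closed {(z, t). h z \<le> ereal t}" "convex {(z, t). h z \<le> ereal t}"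
    and u: "u \<in> subdifferential (conjugate h) p"
  shows "p \<in> subdifferential h u"
proof -
  obtain c where c: "conjugate h p = ereal c"
    using u by (cases "conjugate h p") (auto simp: subdifferential_def)
  have sub: "ereal (c + u \<bullet> (q - p)) \<le> conjugate h q" for q
    using u c by (auto simp: subdifferential_def)
  have sub': "c + u \<bullet> (q - p) \<le> r" if "conjugate h q \<le> ereal r" for q r
    using order_trans[OF sub that] by simp
  have cle: "z \<bullet> p - t \<le> c" if "h z \<le> ereal t" for z t
    using conjugate_le_iff[OF h(1), of p c] c that by auto
  define s where "s = u \<bullet> p - c"
  have hu: "h u \<le> ereal s"
  proof (rule ccontr)
    assume nle: "\<not> h u \<le> ereal s"
    obtain a b k where ab: "a \<bullet> u + b * s < k" "b \<ge> 0"
      and sep: "\<forall>z t. h z \<le> ereal t \<longrightarrow> k < a \<bullet> z + b * t"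
      by (rule epigraph_separation[OF h nle])
    show False
    proof (cases "b = 0")
      case True
      \<comment> \<open>A vertical hyperplane gives no affine minorant by itself, but tilting
        \<open>p\<close> by \<open>- a\<close> brings the conjugate to at most \<open>c - k\<close>,
        below the bound \<open>c - a \<bullet> u\<close> that \<open>u\<close> imposes.\<close>
      have "conjugate h (p - a) \<le> ereal (c - k)"
        unfolding conjugate_le_iff[OF h(1)]
      proof (intro allI impI)
        fix z t assume "h z \<le> ereal t"
        then show "z \<bullet> (p - a) - t \<le> c - k"
          using sep[rule_format, of z t] cle[of z t] True by (simp add: inner_diff_right inner_commute)
      qed
      from sub'[OF this] show False
        using ab True by (simp add: inner_commute)
    next
      case False
      then have b: "b > 0" using ab by simp
      \<comment> \<open>Solved for \<open>t\<close>, the hyperplane is the graph of an affine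
        minorant of \<open>h\<close> with this slope.\<close>
      have "conjugate h (- (1/b) *\<^sub>R a) \<le> ereal (- (k / b))"
        unfolding conjugate_le_iff[OF h(1)]
      proof (intro allI impI)
        fix z t assume "h z \<le> ereal t"
        then have "k / b < (a \<bullet> z + b * t) / b"
          using sep[rule_format, of z t] b by (intro divide_strict_right_mono)
        then show "z \<bullet> (- (1/b) *\<^sub>R a) - t \<le> - (k / b)"
          using b by (simp add: add_divide_distrib inner_commute)
      qed
      from sub'[OF this] have "k / b \<le> s + (a \<bullet> u) / b"
        by (simp add: s_def inner_diff_right inner_commute)
      then have "k \<le> b * s + a \<bullet> u"
        using b by (simp add: field_simps)
      then show False
        using ab by simp
    qed
  qed
  obtain r where r: "h u = ereal r"
    using hu h(1) by (cases "h u") (auto simp: proper_def)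
  show ?thesis
    unfolding mem_subdifferential_iff[of h u r, OF r]
  proof (intro allI impI)
    fix z t assume "h z \<le> ereal t"
    then show "r + p \<bullet> (z - u) \<le> t"
      using cle[of z t] hu r by (simp add: s_def inner_diff_right inner_commute)
  qed
qed

text \<open>A point one unit below the graph is separated from the epigraph. The graph point above
  it lies on the other side, so the hyperplane is not vertical.\<close>

lemma affine_minorant_exists:
  fixes h :: "'a::euclidean_space \<Rightarrow> ereal"
  assumes h: "proper h" "closed {(z, t). h z \<le> ereal t}" "convex {(z, t). h z \<le> ereal t}"
  obtains q c where "\<And>z t. h z \<le> ereal t \<Longrightarrow> q \<bullet> z + c \<le> t"
proof -
  obtain z0 t0 where zt: "h z0 = ereal t0"
    using h(1) unfolding proper_def by (metis real_of_ereal.cases)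
  then have nle: "\<not> h z0 \<le> ereal (t0 - 1)"
    by simp
  obtain a b k where ab: "a \<bullet> z0 + b * (t0 - 1) < k" "b \<ge> 0"
    and sep: "\<forall>z t. h z \<le> ereal t \<longrightarrow> k < a \<bullet> z + b * t"
    by (rule epigraph_separation[OF h nle])
  have "k < a \<bullet> z0 + b * t0"
    by (rule sep[rule_format]) (simp add: zt)
  then have b: "b > 0"
    using ab by (cases "b = 0") (auto simp: algebra_simps)
  show thesis
  proof
    fix z t assume "h z \<le> ereal t"
    then have "k / b < (a \<bullet> z + b * t) / b"
      using sep[rule_format, of z t] b by (intro divide_strict_right_mono)
    then show "(- (1/b) *\<^sub>R a) \<bullet> z + k / b \<le> t"
      using b by (simp add: add_divide_distrib)
  qed
qed

text \<open>Lowering one coordinate cannot raise \<open>h\<close>, yet with a negative slope it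
  would raise the minorant without bound.\<close>

lemma affine_minorant_nonneg:
  fixes h :: "real ^ 's \<Rightarrow> ereal"
  assumes "proper h" "mono h" and min: "\<And>z t. h z \<le> ereal t \<Longrightarrow> q \<bullet> z + c \<le> t"
  shows "0 \<le> q $ i"
proof (rule ccontr)
  assume neg: "\<not> 0 \<le> q $ i"
  obtain z t where zt: "h z = ereal t"
    using assms(1) unfolding proper_def by (metis real_of_ereal.cases)
  \<comment> \<open>Step length at which the minorant reaches \<open>t + 1\<close>.\<close>
  define l where "l = (t + 1 - q \<bullet> z - c) / (- q $ i)"
  have "q \<bullet> z + c \<le> t"
    by (rule min) (simp add: zt)
  then have "l \<ge> 0"
    unfolding l_def using neg by (intro divide_nonneg_pos) auto
  then have "z - l *\<^sub>R axis i 1 \<le> z"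
    by (auto simp: less_eq_vec_def axis_def)
  from monoD[OF \<open>mono h\<close> this] have "q \<bullet> (z - l *\<^sub>R axis i 1) + c \<le> t"
    by (intro min) (simp add: zt)
  then have "q \<bullet> z - l * q $ i + c \<le> t"
    by (simp add: inner_diff_right inner_axis)
  then show False
    using neg by (simp add: l_def)
qed

text \<open>A subgradient is the slope of an affine minorant. Nonnegative multipliers keep
  \<open>G (x, y) \<bullet> p\<close> convex in \<open>y\<close>.\<close>

lemma subgradient_nonneg:
  fixes h :: "real ^ 's \<Rightarrow> ereal"
  assumes "proper h" "mono h" "p \<in> subdifferential h u"
  shows "0 \<le> p $ i"
proof -
  obtain r where r: "h u = ereal r"
    using assms(3) by (cases "h u") (auto simp: subdifferential_def)
  show ?thesis
    using assms mem_subdifferential_iff[of h u r p] r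
    by (intro affine_minorant_nonneg[where c = "r - p \<bullet> u"]) (force simp: inner_diff_right)+
qed

lemma subdifferential_monotone:
  assumes "u \<in> subdifferential f p" "v \<in> subdifferential f q"
  shows "0 \<le> (u - v) \<bullet> (p - q)"
proof -
  obtain r s where r: "f p = ereal r" and s: "f q = ereal s"
    using assms by (cases "f p"; cases "f q") (auto simp: subdifferential_def)
  have "r + u \<bullet> (q - p) \<le> s" "s + v \<bullet> (p - q) \<le> r"
    using assms r s using mem_subdifferential_iff[of f p r u, OF r] mem_subdifferential_iff[of f q s v, OF s]
    by auto
  then show ?thesis
    by (simp add: inner_diff_left inner_diff_right)
qed

text \<open>Only the constraints active at \<open>x\<close> restrict small steps, so the cone is a
  finite intersection of closed halfspaces. Its closedness is the polyhedral gain: for a general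
  closed convex set it can fail.\<close>

lemma polyhedron_feasible_directions:
  fixes S :: "'a::euclidean_space set"
  assumes S: "polyhedron S" and x: "x \<in> S"
  shows "closed {d. \<exists>e>0. x + e *\<^sub>R d \<in> S}" (is "closed ?T")
    and "convex_cone {d. \<exists>e>0. x + e *\<^sub>R d \<in> S}"
proof -
  obtain F where F: "finite F" "S = \<Inter>F" and "\<forall>H\<in>F. \<exists>a b. a \<noteq> 0 \<and> H = {z. a \<bullet> z \<le> b}"
    using S unfolding polyhedron_def by blast
  then obtain a b where H: "\<And>H. H \<in> F \<Longrightarrow> H = {z. a H \<bullet> z \<le> b H}"
    by metis
  have xH: "a H \<bullet> x \<le> b H" if "H \<in> F" for H
    using x that H F(2) by blast
  define A where "A = {H \<in> F. a H \<bullet> x = b H}"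
  have T: "?T = (\<Inter>H\<in>A. {d. a H \<bullet> d \<le> 0})" (is "_ = ?R")
  proof (intro subset_antisym subsetI)
    fix d assume "d \<in> ?T"
    then obtain e where e: "e > 0" "x + e *\<^sub>R d \<in> S" by blast
    show "d \<in> ?R"
    proof
      fix H assume HA: "H \<in> A"
      then have "x + e *\<^sub>R d \<in> {z. a H \<bullet> z \<le> b H}"
        using H e F(2) by (auto simp: A_def)
      then show "d \<in> {d. a H \<bullet> d \<le> 0}"
        using HA e(1) by (simp add: A_def inner_add_right mult_le_0_iff)
    qed
  next
    fix d assume d: "d \<in> ?R"
    \<comment> \<open>An inactive constraint has slack at \<open>x\<close> and survives small steps;
      finiteness of \<open>F\<close> then gives one step length for all constraints.\<close>
    have "\<forall>\<^sub>F e in at_right 0. x + e *\<^sub>R d \<in> H" if HF: "H \<in> F" for H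
    proof (cases "H \<in> A")
      case True
      have "x + e *\<^sub>R d \<in> H" if "e > 0" for e
        using True that d by (subst H[OF HF]) (auto simp: A_def inner_add_right mult_le_0_iff)
      then show ?thesis
        by (simp add: eventually_at_filter)
    next
      case False
      then have "a H \<bullet> x < b H"
        using xH[OF HF] HF by (auto simp: A_def)
      moreover have "((\<lambda>e. a H \<bullet> (x + e *\<^sub>R d)) \<longlongrightarrow> a H \<bullet> (x + 0 *\<^sub>R d)) (at_right 0)"
        by (intro tendsto_intros)
      ultimately have "\<forall>\<^sub>F e in at_right 0. a H \<bullet> (x + e *\<^sub>R d) < b H"
        by (intro order_tendstoD) auto
      then show ?thesis
        by eventually_elim (subst H[OF HF], simp)
    qed
    then have "\<forall>\<^sub>F e in at_right 0. \<forall>H\<in>F. x + e *\<^sub>R d \<in> H"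
      using F(1) by (simp add: eventually_ball_finite)
    moreover have "\<forall>\<^sub>F e::real in at_right 0. e > 0"
      by (simp add: eventually_at_filter)
    ultimately have "\<forall>\<^sub>F e in at_right 0. e > 0 \<and> x + e *\<^sub>R d \<in> S"
      by eventually_elim (use F(2) in auto)
    then show "d \<in> ?T"
      using eventually_happens trivial_limit_at_right_real by fastforce
  qed
  show "closed ?T"
    unfolding T by (intro closed_INT ballI closed_halfspace_le)
  have "convex_cone {d. a H \<bullet> d \<le> 0}" for H
    by (rule convex_cone_halfspace_le)
  then show "convex_cone ?T"
    unfolding T by (auto intro: convex_cone_Inter)
qed

section \<open>Stability of the subdifferential\<close>

lemma rel_interior_add_span:
  fixes C :: "'a::euclidean_space set"
  assumes "u \<in> rel_interior C"
  obtains \<delta> where "\<delta> > 0" "\<And>w. w \<in> span ((\<lambda>w. w - u) ` C) \<Longrightarrow> norm w < \<delta> \<Longrightarrow> u + w \<in> C"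
proof -
  obtain \<delta> where uC: "u \<in> C" and \<delta>: "\<delta> > 0" "ball u \<delta> \<inter> affine hull C \<subseteq> C"
    using assms unfolding mem_rel_interior_ball by blast
  show thesis
  proof
    fix w assume w: "w \<in> span ((\<lambda>w. w - u) ` C)" "norm w < \<delta>"
    then obtain a where "a \<in> affine hull C" "w = a - u"
      using diffs_affine_hull_span[OF uC] by blast
    moreover have "u + w \<in> ball u \<delta>"
      using w(2) by (simp add: dist_norm)
    ultimately show "u + w \<in> C"
      using \<delta>(2) by auto
  qed fact
qed

text \<open>From a relative interior point each direction \<open>w - u\<close> can also be followed
  backwards, so the inequalities of the normal cone become equations. This is what makes the
  critical cone a subspace.\<close>

lemma normal_cone_rel_interior:
  fixes C :: "'a::euclidean_space set"
  assumes u: "u \<in> rel_interior C"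
  shows "normal_cone C u = (span ((\<lambda>w. w - u) ` C))\<^sup>\<bottom>"
proof (intro subset_antisym subsetI)
  have uC: "u \<in> C"
    using u rel_interior_subset by blast
  fix v assume v: "v \<in> normal_cone C u"
  obtain \<delta> where \<delta>: "\<delta> > 0" "\<And>w. w \<in> span ((\<lambda>w. w - u) ` C) \<Longrightarrow> norm w < \<delta> \<Longrightarrow> u + w \<in> C"
    using rel_interior_add_span[OF u] by metis
  have "v \<bullet> x = 0" if x: "x \<in> (\<lambda>w. w - u) ` C" for x
  proof -
    obtain w where w: "w \<in> C" "x = w - u"
      using x by blast
    \<comment> \<open>Scaled so that \<open>t *\<^sub>R x\<close> is shorter than \<delta>; the
      summand 1 covers \<open>x = 0\<close>.\<close>
    define t where "t = \<delta> / (2 * (norm x + 1))"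
    have t: "t > 0"
      using \<delta>(1) by (simp add: t_def add_nonneg_pos)
    have "norm (- t *\<^sub>R x) = \<delta> * (norm x / (2 * (norm x + 1)))"
      using t \<delta>(1) by (simp add: t_def)
    also have "\<dots> < \<delta> * 1"
      using \<delta>(1) norm_ge_zero[of x] by (intro mult_strict_left_mono) (auto simp: divide_simps simp del: norm_ge_zero)
    finally have "norm (- t *\<^sub>R x) < \<delta>"
      by simp
    then have "u + (- t *\<^sub>R x) \<in> C"
      by (intro \<delta>(2) span_scale span_base x)
    then have "v \<bullet> (- t *\<^sub>R x) \<le> 0"
      using v unfolding normal_cone_def by force
    then have "0 \<le> v \<bullet> x"
      using t by (simp add: zero_le_mult_iff)
    moreover have "v \<bullet> x \<le> 0"
      using v w by (simp add: normal_cone_def)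
    ultimately show ?thesis by simp
  qed
  then show "v \<in> (span ((\<lambda>w. w - u) ` C))\<^sup>\<bottom>"
    unfolding orthogonal_comp_def
    using orthogonal_to_span[of _ "(\<lambda>w. w - u) ` C" v] by (auto simp: orthogonal_def inner_commute)
next
  fix v assume v: "v \<in> (span ((\<lambda>w. w - u) ` C))\<^sup>\<bottom>"
  have "v \<bullet> (w - u) = 0" if "w \<in> C" for w
  proof -
    have "w - u \<in> span ((\<lambda>w. w - u) ` C)"
      using that by (intro span_base imageI)
    then show ?thesis
      using v unfolding orthogonal_comp_def orthogonal_def by (auto simp: inner_commute[of v])
  qed
  then show "v \<in> normal_cone C u"
    using u rel_interior_subset by (fastforce simp: normal_cone_def)
qed

text \<open>
  In the directions of the critical cone, a polyhedral \<open>h\<close> grows at least linearly above its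
  affine minorant \<open>p\<close> at \<open>u\<close>; this leaves room to tilt \<open>p\<close>.
\<close>

lemma epi_polyhedral_subdifferential_stable:
  fixes h :: "'a::euclidean_space \<Rightarrow> ereal"
  assumes h: "proper h" "epi_polyhedral h"
    and u: "u \<in> rel_interior (subdifferential (conjugate h) p)"
  defines "K \<equiv> critical_cone (conjugate h) p u"
  obtains \<delta> where "\<delta> > 0"
    "\<And>v w. v \<in> K \<Longrightarrow> w \<in> K\<^sup>\<bottom> \<Longrightarrow> norm v < \<delta> \<Longrightarrow> norm w < \<delta>
      \<Longrightarrow> u + w \<in> subdifferential (conjugate h) (p + v)"
proof -
  define C where "C = subdifferential (conjugate h) p"
  define W where "W = span ((\<lambda>w. w - u) ` C)"
  define E where "E = {(z, t). h z \<le> ereal t}"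
  have polyE: "polyhedron E"
    using h(2) by (simp add: epi_polyhedral_def E_def)
  have hE: "closed {(z, t). h z \<le> ereal t}" "convex {(z, t). h z \<le> ereal t}"
    using polyE polyhedron_imp_closed polyhedron_imp_convex by (auto simp: E_def)
  have uC: "u \<in> C" 
    using u rel_interior_subset by (auto simp: C_def)
  have subW: "subspace W"
    by (simp add: W_def)
  have K: "K = W\<^sup>\<bottom>"
    using u normal_cone_rel_interior by (auto simp: K_def critical_cone_def W_def C_def)
  have subK: "subspace K"
    by (simp add: K subspace_orthogonal_comp)
  have WK: "K\<^sup>\<bottom> = W"
    using orthogonal_comp_self[OF subW] by (simp add: K)
  have orth: "v \<bullet> w = 0" if "v \<in> K" "w \<in> W" for v w
    using that unfolding K orthogonal_comp_def orthogonal_def by (auto simp: inner_commute)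
  obtain \<delta>0 where \<delta>0: "\<delta>0 > 0" "\<And>w. w \<in> W \<Longrightarrow> norm w < \<delta>0 \<Longrightarrow> u + w \<in> C"
    using rel_interior_add_span[OF u[folded C_def]] unfolding W_def by metis
  have subgrad: "p \<in> subdifferential h z" if "z \<in> C" for z
    using subdifferential_conjugateD[OF h(1) hE, of z p] that by (simp add: C_def)
  obtain r where r: "h u = ereal r"
    using subgrad[OF uC] by (cases "h u") (auto simp: subdifferential_def)
  have supp: "r + p \<bullet> (z - u) \<le> t" if "(z, t) \<in> E" for z t
    using mem_subdifferential_iff[of h u r p] r subgrad[OF uC] that by (auto simp: E_def)
  \<comment> \<open>\<open>p\<close> is a subgradient at both \<open>z\<close> and \<open>u\<close>;
    the two inequalities pinch \<open>h z\<close>.\<close>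
  have C_affine: "h z = ereal (r + p \<bullet> (z - u))" if z: "z \<in> C" for z
  proof -
    obtain s where s: "h z = ereal s"
      using subgrad[OF z] by (cases "h z") (auto simp: subdifferential_def)
    have "s + p \<bullet> (u - z) \<le> r"
      using mem_subdifferential_iff[of h z s p] s subgrad[OF z] r by auto
    moreover have "r + p \<bullet> (z - u) \<le> s"
      by (rule supp) (simp add: E_def s)
    ultimately show ?thesis
      using s by (simp add: inner_diff_right)
  qed
  \<comment> \<open>Tangent cone of the epigraph at \<open>(u, r)\<close>. Over \<open>W\<close> it
    contains the directions of slope exactly \<open>p\<close>; over \<open>K\<close> its nonzero
    directions must rise strictly faster.\<close>
  define T where "T = {d. \<exists>e>0. (u, r) + e *\<^sub>R d \<in> E}"
  have urE: "(u, r) \<in> E"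
    by (simp add: E_def r)
  have closedT: "closed T" and coneT: "convex_cone T"
    using polyhedron_feasible_directions[OF polyE urE] by (auto simp: T_def)
  have ET: "(z - u, t - r) \<in> T" if "(z, t) \<in> E" for z t
    unfolding T_def using that by (auto intro!: exI[of _ 1])
  have WT: "(w, p \<bullet> w) \<in> T" if w: "w \<in> W" for w
  proof -
    define e where "e = \<delta>0 / (2 * (norm w + 1))"
    have e: "e > 0"
      using \<delta>0(1) by (simp add: e_def add_nonneg_pos)
    have "norm (e *\<^sub>R w) = \<delta>0 * (norm w / (2 * (norm w + 1)))"
      using e \<delta>0(1) by (simp add: e_def)
    also have "\<dots> < \<delta>0 * 1"
      using \<delta>0(1) norm_ge_zero[of w] by (intro mult_strict_left_mono) (auto simp: divide_simps simp del: norm_ge_zero)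
    finally have "u + e *\<^sub>R w \<in> C"
      using w by (intro \<delta>0(2)) (auto simp: W_def span_scale)
    then have "(u, r) + e *\<^sub>R (w, p \<bullet> w) \<in> E"
      using C_affine[of "u + e *\<^sub>R w"] by (simp add: E_def)
    then show ?thesis
      unfolding T_def using e by blast
  qed
  have Tpos: "p \<bullet> d \<le> \<tau>" if d: "(d, \<tau>) \<in> T" for d \<tau>
  proof -
    obtain e where e: "e > 0" "(u + e *\<^sub>R d, r + e * \<tau>) \<in> E"
      using d by (auto simp: T_def)
    from supp[OF e(2)] show ?thesis
      using e(1) by simp
  qed
  \<comment> \<open>If \<open>h\<close> grows only with slope \<open>p\<close> along
    \<open>d\<close>, then \<open>p\<close> is a subgradient further along, so that point belongs to
    \<open>C\<close> and \<open>d\<close> to \<open>W\<close>. Being in \<open>K\<close> as well,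
    \<open>d\<close> is orthogonal to itself.\<close>
  have Tstrict: "d = 0" if d: "(d, p \<bullet> d) \<in> T" "d \<in> K" for d
  proof -
    obtain e where e: "e > 0" "(u + e *\<^sub>R d, r + e * (p \<bullet> d)) \<in> E"
      using d(1) by (auto simp: T_def)
    have hd: "h (u + e *\<^sub>R d) = ereal (r + e * (p \<bullet> d))"
    proof (cases "h (u + e *\<^sub>R d)")
      case (real s)
      then show ?thesis
        using supp[of "u + e *\<^sub>R d" s] e by (auto simp: E_def)
    qed (use e(2) h(1) in \<open>auto simp: E_def proper_def\<close>)
    have "p \<in> subdifferential h (u + e *\<^sub>R d)"
      using mem_subdifferential_iff[of h "u + e *\<^sub>R d" _ p, OF hd] supp
      by (auto simp: E_def inner_diff_right inner_add_right)
    then have "u + e *\<^sub>R d \<in> C"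
      unfolding C_def by (rule subdifferential_conjugateI)
    then have "e *\<^sub>R d \<in> W"
      unfolding W_def by (intro span_base) force
    then have "d \<bullet> (e *\<^sub>R d) = 0"
      using d(2) by (intro orth)
    then show ?thesis
      using e(1) by simp
  qed
  \<comment> \<open>The growth bound is homogeneous, so its constant can be taken as a minimum over
    a slice of the unit sphere. Compactness of the slice rests on closedness of
    \<open>T\<close>.\<close>
  define X where "X = T \<inter> (K \<times> UNIV) \<inter> sphere 0 1"
  have "compact X"
    unfolding X_def
    by (intro closed_Int_compact closed_Int closedT closed_Times closed_subspace subK) auto
  \<comment> \<open>The vertical direction is always feasible and keeps the slice nonempty.\<close>
  moreover have "(0, 1) \<in> X"
    using ET[of u "r + 1"] r subspace_0[OF subK] by (auto simp: X_def E_def norm_Pair)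
  moreover have "continuous_on X (\<lambda>x. snd x - p \<bullet> fst x)"
    by (intro continuous_intros)
  ultimately obtain x0 where x0: "x0 \<in> X" "\<And>x. x \<in> X \<Longrightarrow> snd x0 - p \<bullet> fst x0 \<le> snd x - p \<bullet> fst x"
    using continuous_attains_inf[of X] by blast
  define \<kappa> where "\<kappa> = snd x0 - p \<bullet> fst x0"
  have \<kappa>: "\<kappa> > 0"
  proof (rule ccontr)
    assume "\<not> \<kappa> > 0"
    moreover have x0T: "(fst x0, snd x0) \<in> T" and x0K: "fst x0 \<in> K"
      using x0(1) by (auto simp: X_def)
    ultimately have eq: "snd x0 = p \<bullet> fst x0"
      using Tpos[OF x0T] by (simp add: \<kappa>_def)
    with x0T x0K have "fst x0 = 0"
      by (intro Tstrict) auto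
    with eq have "x0 = 0"
      by (simp add: prod_eq_iff)
    then show False
      using x0(1) by (simp add: X_def)
  qed
  have growth: "\<kappa> * norm d \<le> \<tau> - p \<bullet> d" if d: "(d, \<tau>) \<in> T" "d \<in> K" for d \<tau>
  proof (cases "(d, \<tau>) = 0")
    case False
    define n where "n = norm (d, \<tau>)"
    have n: "n > 0"
      using False by (simp add: n_def)
    have "(1 / n) *\<^sub>R (d, \<tau>) \<in> T"
      using n d by (intro convex_cone_scaleR coneT) auto
    moreover have "(1 / n) *\<^sub>R d \<in> K"
      using d(2) subK by (rule subspace_scale[rotated])
    moreover have "norm ((1 / n) *\<^sub>R (d, \<tau>)) = 1"
      using n unfolding norm_scaleR by (simp flip: n_def)
    ultimately have "(1 / n) *\<^sub>R (d, \<tau>) \<in> X"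
      by (simp add: X_def)
    from x0(2)[OF this] have "\<kappa> \<le> (\<tau> - p \<bullet> d) / n"
      by (simp add: \<kappa>_def diff_divide_distrib)
    then have "\<kappa> * n \<le> \<tau> - p \<bullet> d"
      using n by (simp add: field_simps)
    moreover have "norm d \<le> n"
      unfolding n_def by (metis fst_conv norm_fst_le)
    ultimately show ?thesis
      using \<kappa> by (meson mult_left_mono less_imp_le order_trans)
  qed (auto simp: zero_prod_def)
  show thesis
  proof
    \<comment> \<open>\<open>\<kappa>\<close> limits the tilt \<open>v\<close> that the growth can
      absorb; \<open>\<delta>0\<close> keeps \<open>u + w\<close> inside \<open>C\<close>.\<close>
    show "min \<kappa> \<delta>0 > 0"
      using \<kappa> \<delta>0 by simp
    fix v w assume v: "v \<in> K" "norm v < min \<kappa> \<delta>0" and "w \<in> K\<^sup>\<bottom>" and wn: "norm w < min \<kappa> \<delta>0"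
    then have w: "w \<in> W"
      by (simp add: WK)
    have "u + w \<in> C"
      using w wn by (intro \<delta>0(2)) auto
    from C_affine[OF this] have hw: "h (u + w) = ereal (r + p \<bullet> w)"
      by simp
    have "p + v \<in> subdifferential h (u + w)"
      unfolding mem_subdifferential_iff[of h "u + w" _ "p + v", OF hw]
    proof (intro allI impI)
      fix z t assume "h z \<le> ereal t"
      then have zt: "(z - u, t - r) \<in> T"
        by (intro ET) (simp add: E_def)
      obtain w' k where wk: "w' \<in> W" "\<And>y. y \<in> W \<Longrightarrow> orthogonal k y" "z - u = w' + k"
        using orthogonal_subspace_decomp_exists[of W "z - u"] by (metis subW span_eq_iff)
      have kK: "k \<in> K"
        using wk(2) by (auto simp: K orthogonal_comp_def orthogonal_commute)
      \<comment> \<open>Moving back along \<open>W\<close> changes the height by exactly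
        \<open>- p \<bullet> w'\<close>, so the growth bound over \<open>K\<close> applies to the
        remaining component \<open>k\<close>.\<close>
      have "(- w', p \<bullet> (- w')) \<in> T"
        using wk(1) subW by (intro WT) (auto simp: subspace_neg)
      from convex_cone_add[OF coneT zt this] have "(k, t - r - p \<bullet> w') \<in> T"
        by (simp add: wk(3))
      from growth[OF this kK] have "\<kappa> * norm k \<le> t - r - p \<bullet> w' - p \<bullet> k" .
      moreover have "v \<bullet> k \<le> norm v * norm k"
        by (rule norm_cauchy_schwarz)
      moreover have "norm v * norm k \<le> \<kappa> * norm k"
        using v(2) by (intro mult_right_mono) auto
      moreover have "v \<bullet> w' = 0" "v \<bullet> w = 0"
        using orth v(1) wk(1) w by auto
      moreover have z: "z - (u + w) = w' + k - w"
        using wk(3) by (simp add: algebra_simps)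
      ultimately show "r + p \<bullet> w + (p + v) \<bullet> (z - (u + w)) \<le> t"
        unfolding z by (simp add: inner_diff_right inner_add_right inner_add_left)
    qed
    then show "u + w \<in> subdifferential (conjugate h) (p + v)"
      by (rule subdifferential_conjugateI)
  qed
qed

section \<open>Continuously differentiable maps and partial derivatives\<close>

text \<open>In finite dimension, continuity of the derivative in operator norm reduces to continuity
  of its values on basis vectors.\<close>

lemma C1_onI:
  fixes f :: "'a::euclidean_space \<Rightarrow> 'b::real_normed_vector"
  assumes der: "\<And>x. x \<in> U \<Longrightarrow> (f has_derivative D x) (at x)"
    and cont: "\<And>b. b \<in> Basis \<Longrightarrow> continuous_on U (\<lambda>x. D x b)"
  shows "C1_on U f"
  unfolding C1_on_def
proof (intro exI conjI ballI)
  have app: "blinfun_apply (Blinfun (D x)) = D x" if "x \<in> U" for x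
    using der[OF that] by (intro bounded_linear_Blinfun_apply has_derivative_bounded_linear)
  show "(f has_derivative blinfun_apply (Blinfun (D x))) (at x)" if "x \<in> U" for x
    using der[OF that] app[OF that] by simp
  show "continuous_on U (\<lambda>x. Blinfun (D x))"
  proof (rule continuous_on_blinfun_componentwise)
    fix b :: 'a assume "b \<in> Basis"
    from cont[OF this] show "continuous_on U (\<lambda>x. blinfun_apply (Blinfun (D x)) b)"
      by (rule continuous_on_eq) (simp add: app)
  qed
qed

lemma C1_onE:
  assumes "C1_on U f"
  obtains D where "\<And>x. x \<in> U \<Longrightarrow> (f has_derivative D x) (at x)"
    "\<And>v. continuous_on U (\<lambda>x. D x v)"
proof -
  obtain f' where f': "\<forall>x\<in>U. (f has_derivative blinfun_apply (f' x)) (at x)" "continuous_on U f'"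
    using assms unfolding C1_on_def by blast
  show thesis
    by (rule that[of "\<lambda>x. blinfun_apply (f' x)"]) (use f' in \<open>auto intro!: continuous_intros\<close>)
qed

lemma C1_on_imp_continuous_on:
  assumes "C1_on U f"
  shows "continuous_on U f"
  using assms C1_onE has_derivative_continuous continuous_at_imp_continuous_on by metis

lemma C1_on_bounded_linear:
  fixes l :: "'a::euclidean_space \<Rightarrow> 'b::real_normed_vector"
  assumes "bounded_linear l"
  shows "C1_on U l"
  by (rule C1_onI[where D = "\<lambda>_. l"]) (use assms bounded_linear_imp_has_derivative in auto)

lemma C1_on_compose:
  fixes f :: "'a::euclidean_space \<Rightarrow> 'b::euclidean_space"
  assumes f: "C1_on U f" and k: "C1_on V k" and "f ` U \<subseteq> V"
  shows "C1_on U (\<lambda>x. k (f x))"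
proof -
  obtain D where D: "\<And>x. x \<in> U \<Longrightarrow> (f has_derivative D x) (at x)" "\<And>v. continuous_on U (\<lambda>x. D x v)"
    using C1_onE[OF f] by metis
  obtain k' where k': "\<forall>x\<in>V. (k has_derivative blinfun_apply (k' x)) (at x)" "continuous_on V k'"
    using k unfolding C1_on_def by blast
  show ?thesis
  proof (rule C1_onI[where D = "\<lambda>x d. k' (f x) (D x d)"])
    fix x assume "x \<in> U"
    then show "((\<lambda>x. k (f x)) has_derivative (\<lambda>d. k' (f x) (D x d))) (at x)"
      using assms(3) k'(1) by (intro has_derivative_compose[OF D(1)]) auto
  next
    fix b :: 'a
    show "continuous_on U (\<lambda>x. k' (f x) (D x b))"
      by (intro continuous_intros continuous_on_compose2[OF k'(2)] D(2) C1_on_imp_continuous_on f assms)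
  qed
qed

lemma C1_on_add:
  fixes f :: "'a::euclidean_space \<Rightarrow> 'b::real_normed_vector"
  assumes f: "C1_on U f" and k: "C1_on U k"
  shows "C1_on U (\<lambda>x. f x + k x)"
proof -
  obtain D where D: "\<And>x. x \<in> U \<Longrightarrow> (f has_derivative D x) (at x)" "\<And>v. continuous_on U (\<lambda>x. D x v)"
    using C1_onE[OF f] by metis
  obtain E where E: "\<And>x. x \<in> U \<Longrightarrow> (k has_derivative E x) (at x)" "\<And>v. continuous_on U (\<lambda>x. E x v)"
    using C1_onE[OF k] by metis
  show ?thesis
    by (rule C1_onI[where D = "\<lambda>x d. D x d + E x d"])
      (auto intro!: has_derivative_add D E continuous_intros)
qed

lemma C1_on_Pair:
  fixes f :: "'a::euclidean_space \<Rightarrow> 'b::real_normed_vector"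
    and k :: "'a \<Rightarrow> 'c::real_normed_vector"
  assumes f: "C1_on U f" and k: "C1_on U k"
  shows "C1_on U (\<lambda>x. (f x, k x))"
proof -
  obtain D where D: "\<And>x. x \<in> U \<Longrightarrow> (f has_derivative D x) (at x)" "\<And>v. continuous_on U (\<lambda>x. D x v)"
    using C1_onE[OF f] by metis
  obtain E where E: "\<And>x. x \<in> U \<Longrightarrow> (k has_derivative E x) (at x)" "\<And>v. continuous_on U (\<lambda>x. E x v)"
    using C1_onE[OF k] by metis
  show ?thesis
    by (rule C1_onI[where D = "\<lambda>x d. (D x d, E x d)"])
      (auto intro!: has_derivative_Pair D E continuous_intros)
qed

lemma C1_on_bilinear:
  fixes f :: "'a::euclidean_space \<Rightarrow> 'b::real_normed_vector"
    and k :: "'a \<Rightarrow> 'c::real_normed_vector"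
  assumes b: "bounded_bilinear B" and f: "C1_on U f" and k: "C1_on U k"
  shows "C1_on U (\<lambda>x. B (f x) (k x))"
proof -
  obtain D where D: "\<And>x. x \<in> U \<Longrightarrow> (f has_derivative D x) (at x)" "\<And>v. continuous_on U (\<lambda>x. D x v)"
    using C1_onE[OF f] by metis
  obtain E where E: "\<And>x. x \<in> U \<Longrightarrow> (k has_derivative E x) (at x)" "\<And>v. continuous_on U (\<lambda>x. E x v)"
    using C1_onE[OF k] by metis
  show ?thesis
  proof (rule C1_onI)
    show "((\<lambda>x. B (f x) (k x)) has_derivative (\<lambda>d. B (f x) (E x d) + B (D x d) (k x))) (at x)"
      if "x \<in> U" for x
      using that by (intro bounded_bilinear.FDERIV[OF b] D E)
    show "continuous_on U (\<lambda>x. B (f x) (E x i) + B (D x i) (k x))" for i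
      by (intro continuous_on_add bounded_bilinear.continuous_on[OF b] D E C1_on_imp_continuous_on f k)
  qed
qed

lemma C2E:
  fixes f :: "'a::euclidean_space \<Rightarrow> 'b::real_normed_vector"
  assumes "C2 f"
  obtains f' :: "'a \<Rightarrow> 'a \<Rightarrow>\<^sub>L 'b"
  where "\<And>x. (f has_derivative blinfun_apply (f' x)) (at x)" "C1_on UNIV f'" "C1_on UNIV f"
proof -
  obtain f' where f': "\<And>x. (f has_derivative blinfun_apply (f' x)) (at x)" "C1_on UNIV f'"
    using assms unfolding C2_def by blast
  moreover have "C1_on UNIV f"
    unfolding C1_on_def using f'(1) C1_on_imp_continuous_on[OF f'(2)] by blast
  ultimately show thesis
    by (rule that)
qed

section \<open>Partial derivatives, gradients and Jacobians\<close>

text \<open>The adjoint of the derivative in the second variable: the transposed partial Jacobian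
  applied to \<open>p\<close>, and for a real-valued map with \<open>p = 1\<close> the partial
  gradient. Bilinearity in \<open>L\<close> and \<open>p\<close> makes the product rule
  available.\<close>

definition partial_adjoint ::
  "(('a::real_normed_vector \<times> 'b::euclidean_space) \<Rightarrow>\<^sub>L 'c::real_inner) \<Rightarrow> 'c \<Rightarrow> 'b" where
  "partial_adjoint L p = (\<Sum>b\<in>Basis. (L (0, b) \<bullet> p) *\<^sub>R b)"

lemma inner_partial_adjoint: "partial_adjoint L p \<bullet> d = L (0, d) \<bullet> p"
proof -
  have lin: "linear (\<lambda>d. L (0, d) \<bullet> p)"
  proof (rule linearI)
    show "L (0, d + e) \<bullet> p = L (0, d) \<bullet> p + L (0, e) \<bullet> p" for d e
      using blinfun.add_right[of L "(0, d)" "(0, e)"] by (simp add: inner_add_left)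
    show "L (0, c *\<^sub>R d) \<bullet> p = c *\<^sub>R (L (0, d) \<bullet> p)" for c d
      using blinfun.scaleR_right[of L c "(0, d)"] by simp
  qed
  have "L (0, d) \<bullet> p = (\<Sum>b\<in>Basis. (d \<bullet> b) * (L (0, b) \<bullet> p))"
    using Linear_Algebra.linear_componentwise[OF lin, of d 1] by simp
  then show ?thesis
    unfolding partial_adjoint_def inner_sum_left inner_scaleR_left
    by (simp add: inner_commute[of d] mult.commute)
qed

lemma bounded_bilinear_partial_adjoint: "bounded_bilinear partial_adjoint"
proof (unfold_locales)
  fix L L' :: "('a::real_normed_vector \<times> 'b::euclidean_space) \<Rightarrow>\<^sub>L 'c::real_inner" and p p' :: 'c and c :: real
  show "partial_adjoint (L + L') p = partial_adjoint L p + partial_adjoint L' p"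
    "partial_adjoint L (p + p') = partial_adjoint L p + partial_adjoint L p'"
    "partial_adjoint (c *\<^sub>R L) p = c *\<^sub>R partial_adjoint L p"
    "partial_adjoint L (c *\<^sub>R p) = c *\<^sub>R partial_adjoint L p"
    by (simp_all add: partial_adjoint_def blinfun.bilinear_simps inner_add_left inner_add_right
        scaleR_left_distrib sum.distrib scaleR_sum_right)
next
  show "\<exists>K. \<forall>(L::('a \<times> 'b) \<Rightarrow>\<^sub>L 'c) p. norm (partial_adjoint L p) \<le> norm L * norm p * K"
  proof (intro exI[of _ 1] allI)
    fix L :: "('a \<times> 'b) \<Rightarrow>\<^sub>L 'c" and p
    define v where "v = partial_adjoint L p"
    \<comment> \<open>The adjoint is tested against its own value, after which one factor
      \<open>norm v\<close> cancels.\<close>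
    have "norm v * norm v = L (0, v) \<bullet> p"
      unfolding v_def by (simp flip: inner_partial_adjoint power2_eq_square add: power2_norm_eq_inner)
    also have "\<dots> \<le> norm (L (0, v)) * norm p"
      by (rule norm_cauchy_schwarz)
    also have "\<dots> \<le> norm L * norm (0 :: 'a, v) * norm p"
      by (intro mult_right_mono norm_blinfun) auto
    finally have "norm v * norm v \<le> norm v * (norm L * norm p)"
      by (simp add: norm_Pair mult_ac)
    then show "norm v \<le> norm L * norm p * 1"
      by (cases "v = 0") auto
  qed
qed

lemma partial_derivative_right:
  assumes "(f has_derivative f') (at (x, y))"
  shows "((\<lambda>y. f (x, y)) has_derivative (\<lambda>d. f' (0, d))) (at y)"
  by (rule has_derivative_compose[of "\<lambda>y. (x, y)" _ _ _ f, OF _ assms]) (auto intro!: derivative_eq_intros)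

lemma partial_derivative_left:
  assumes "(f has_derivative f') (at (x, y))"
  shows "((\<lambda>x. f (x, y)) has_derivative (\<lambda>d. f' (d, 0))) (at x)"
  by (rule has_derivative_compose[of "\<lambda>x. (x, y)" _ _ _ f, OF _ assms]) (auto intro!: derivative_eq_intros)

lemma gradient_eqI:
  assumes "(f has_derivative (\<lambda>d. D \<bullet> d)) (at x)"
  shows "gradient f x = D"
  unfolding gradient_def
proof (rule the_equality)
  show D: "GDERIV f x :> D"
    using assms by (simp add: gderiv_def inner_commute)
  fix D' assume "GDERIV f x :> D'"
  then have "(\<lambda>d. d \<bullet> D') = (\<lambda>d. d \<bullet> D)"
    using D unfolding gderiv_def by (rule has_derivative_unique)
  then show "D' = D"
    by (metis vector_eq_rdot inner_commute)
qed

lemma jacobian_eqI: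
  fixes f :: "real ^ 'a \<Rightarrow> real ^ 'b"
  assumes "(f has_derivative f') (at x)"
  shows "jacobian f (at x) = matrix f'"
  using frechet_derivative_at[OF assms] by (simp add: jacobian_def)

lemma transpose_jacobian_mult:
  fixes G :: "(real ^ 'n) \<times> (real ^ 'm) \<Rightarrow> real ^ 's"
  assumes "(G has_derivative blinfun_apply G') (at (x, y))"
  shows "transpose (jacobian (\<lambda>y. G (x, y)) (at y)) *v p = partial_adjoint G' p"
proof -
  have der: "((\<lambda>y. G (x, y)) has_derivative (\<lambda>d. G' (0, d))) (at y)"
    by (rule partial_derivative_right[OF assms])
  then have "jacobian (\<lambda>y. G (x, y)) (at y) *v d = G' (0, d)" for d
    using jacobian_eqI[OF der] has_derivative_linear[OF der] by (simp add: matrix_works)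
  then have "(transpose (jacobian (\<lambda>y. G (x, y)) (at y)) *v p) \<bullet> d = partial_adjoint G' p \<bullet> d" for d
    by (simp add: inner_partial_adjoint transpose_matrix_vector dot_lmul_matrix) (simp add: inner_commute)
  then show ?thesis
    using vector_eq_rdot by blast
qed

lemma convex_on_tangent_le:
  fixes f :: "'a::real_normed_vector \<Rightarrow> real"
  assumes "convex_on UNIV f" and der: "(f has_derivative D) (at y)"
  shows "f y + D (z - y) \<le> f z"
proof -
  define k where "k = (\<lambda>t. f (y + t *\<^sub>R (z - y)))"
  have "convex_on UNIV k"
  proof (rule convex_onI)
    fix t s r :: real assume t: "0 < t" "t < 1"
    have "y + ((1 - t) *\<^sub>R s + t *\<^sub>R r) *\<^sub>R (z - y)
        = (1 - t) *\<^sub>R (y + s *\<^sub>R (z - y)) + t *\<^sub>R (y + r *\<^sub>R (z - y))"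
      by (simp add: algebra_simps)
    then show "k ((1 - t) *\<^sub>R s + t *\<^sub>R r) \<le> (1 - t) * k s + t * k r"
      unfolding k_def using t by (auto intro!: convex_onD[OF assms(1)])
  qed simp
  moreover have "(k has_derivative (\<lambda>t. D (t *\<^sub>R (z - y)))) (at 0)"
    unfolding k_def by (rule has_derivative_compose[where g = f]) (use der in \<open>auto intro!: derivative_eq_intros\<close>)
  then have "(k has_field_derivative D (z - y)) (at 0)"
    using linear_scale[OF has_derivative_linear[OF der]]
    by (simp add: has_field_derivative_def mult.commute[of _ "D (z - y)"] mult_commute_abs)
  ultimately have "D (z - y) * (1 - 0) \<le> k 1 - k 0"
    by (intro convex_on_imp_above_tangent[where A = UNIV]) auto
  then show ?thesis
    by (simp add: k_def)
qed

section \<open>Existence and uniqueness of solutions\<close>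

text \<open>The gradient in \<open>y\<close> of the part of the Lagrangian that depends on
  \<open>y\<close>. Unlike \<open>grad_y_lagrangian\<close> it keeps this meaning where
  \<open>conjugate h p\<close> is infinite, so it can be differentiated in \<open>p\<close>.\<close>

definition lagrangian_gradient ::
  "((real ^ 'n) \<times> (real ^ 'm) \<Rightarrow> ((real ^ 'n) \<times> (real ^ 'm)) \<Rightarrow>\<^sub>L real) \<Rightarrow>
   ((real ^ 'n) \<times> (real ^ 'm) \<Rightarrow> ((real ^ 'n) \<times> (real ^ 'm)) \<Rightarrow>\<^sub>L (real ^ 's)) \<Rightarrow>
   real \<Rightarrow> real ^ 'n \<Rightarrow> real ^ 'm \<Rightarrow> real ^ 's \<Rightarrow> real ^ 'm" where
  "lagrangian_gradient g' G' \<beta> x y p =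
     partial_adjoint (g' (x, y)) 1 + partial_adjoint (G' (x, y)) p + \<beta> *\<^sub>R y"

lemma inner_lagrangian_gradient:
  "lagrangian_gradient g' G' \<beta> x y p \<bullet> d = g' (x, y) (0, d) + G' (x, y) (0, d) \<bullet> p + \<beta> * (y \<bullet> d)"
  by (simp add: lagrangian_gradient_def inner_add_left inner_partial_adjoint)

lemma has_derivative_half_norm_square:
  fixes f :: "'a::real_normed_vector \<Rightarrow> 'b::real_inner"
  assumes "(f has_derivative f') (at x)"
  shows "((\<lambda>x. c / 2 * (norm (f x))\<^sup>2) has_derivative (\<lambda>d. c * (f x \<bullet> f' d))) (at x)"
  unfolding power2_norm_eq_inner
  by (auto intro!: derivative_eq_intros assms simp: inner_commute fun_eq_iff)

lemma has_derivative_quadratic_lagrangian: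
  assumes "\<And>z. (g has_derivative blinfun_apply (g' z)) (at z)"
    and "\<And>z. (G has_derivative blinfun_apply (G' z)) (at z)"
  shows "((\<lambda>y. g (x, y) + \<beta> / 2 * (norm y)\<^sup>2 + G (x, y) \<bullet> p) has_derivative
           (\<lambda>d. lagrangian_gradient g' G' \<beta> x y p \<bullet> d)) (at y)"
proof -
  have "((\<lambda>y. g (x, y) + \<beta> / 2 * (norm y)\<^sup>2 + G (x, y) \<bullet> p) has_derivative
      (\<lambda>d. g' (x, y) (0, d) + \<beta> * (y \<bullet> d) + G' (x, y) (0, d) \<bullet> p)) (at y)"
    by (intro has_derivative_add has_derivative_half_norm_square has_derivative_inner_left
        has_derivative_ident partial_derivative_right assms)
  then show ?thesis
    by (simp add: inner_lagrangian_gradient add_ac)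
qed

lemma mem_sol_set_iff:
  assumes g': "\<And>z. (g has_derivative blinfun_apply (g' z)) (at z)"
    and G': "\<And>z. (G has_derivative blinfun_apply (G' z)) (at z)"
  shows "(y, p) \<in> sol_set g G h \<alpha> \<beta> x \<longleftrightarrow>
    lagrangian_gradient g' G' \<beta> x y p = 0 \<and> G (x, y) - \<alpha> *\<^sub>R p \<in> subdifferential (conjugate h) p"
proof -
  have "gradient (\<lambda>y. g (x, y)) y = partial_adjoint (g' (x, y)) 1"
    by (rule gradient_eqI) (use partial_derivative_right[OF g'] in \<open>simp add: inner_partial_adjoint\<close>)
  then have "0 = - gradient (\<lambda>y. g (x, y)) y
            - transpose (jacobian (\<lambda>y. G (x, y)) (at y)) *v p - \<beta> *\<^sub>R y \<longleftrightarrow>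
          lagrangian_gradient g' G' \<beta> x y p = 0"
    unfolding lagrangian_gradient_def transpose_jacobian_mult[OF G']
    by (auto simp: algebra_simps eq_neg_iff_add_eq_0 minus_equation_iff)
  moreover have "0 \<in> (\<lambda>u. - G (x, y) + \<alpha> *\<^sub>R p + u) ` S \<longleftrightarrow> G (x, y) - \<alpha> *\<^sub>R p \<in> S" for S
  proof
    assume "0 \<in> (\<lambda>u. - G (x, y) + \<alpha> *\<^sub>R p + u) ` S"
    then obtain u where "u \<in> S" "- G (x, y) + \<alpha> *\<^sub>R p + u = 0"
      by force
    moreover from this have "u = G (x, y) - \<alpha> *\<^sub>R p"
      by (simp add: algebra_simps add_eq_0_iff)
    ultimately show "G (x, y) - \<alpha> *\<^sub>R p \<in> S" by simp
  next
    assume "G (x, y) - \<alpha> *\<^sub>R p \<in> S"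
    then show "0 \<in> (\<lambda>u. - G (x, y) + \<alpha> *\<^sub>R p + u) ` S"
      by (intro image_eqI[of _ _ "G (x, y) - \<alpha> *\<^sub>R p"]) (auto simp: algebra_simps)
  qed
  ultimately show ?thesis
    by (simp add: sol_set_def)
qed

text \<open>Subtracting \<open>\<beta> *\<^sub>R y\<close> leaves the gradient of
  \<open>g (x, y) + G (x, y) \<bullet> p\<close>, a convex function of \<open>y\<close> because
  \<open>p \<ge> 0\<close>; this is its tangent inequality.\<close>

lemma lagrangian_gradient_tangent_le:
  assumes g': "\<And>z. (g has_derivative blinfun_apply (g' z)) (at z)"
    and G': "\<And>z. (G has_derivative blinfun_apply (G' z)) (at z)"
    and convg: "convex_on UNIV (\<lambda>y. g (x, y))"
    and convG: "\<And>i. convex_on UNIV (\<lambda>y. G (x, y) $ i)"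
    and p: "\<And>i. 0 \<le> p $ i"
  shows "g (x, y) + G (x, y) \<bullet> p + (lagrangian_gradient g' G' \<beta> x y p - \<beta> *\<^sub>R y) \<bullet> (z - y)
    \<le> g (x, z) + G (x, z) \<bullet> p"
proof -
  have "convex_on UNIV (\<lambda>y. \<Sum>i\<in>I. p $ i * G (x, y) $ i)" for I
    by (induction I rule: infinite_finite_induct)
      (auto simp: convex_on_const intro!: convex_on_add convex_on_cmul p convG)
  from convex_on_add[OF convg this[of UNIV]] have "convex_on UNIV (\<lambda>y. g (x, y) + G (x, y) \<bullet> p)"
    by (simp add: inner_vec_def mult.commute)
  moreover have "((\<lambda>y. g (x, y) + G (x, y) \<bullet> p) has_derivative
      (\<lambda>d. g' (x, y) (0, d) + G' (x, y) (0, d) \<bullet> p)) (at y)"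
    by (intro has_derivative_add has_derivative_inner_left partial_derivative_right g' G')
  ultimately have "g (x, y) + G (x, y) \<bullet> p + (g' (x, y) (0, z - y) + G' (x, y) (0, z - y) \<bullet> p)
      \<le> g (x, z) + G (x, z) \<bullet> p"
    by (rule convex_on_tangent_le)
  then show ?thesis
    by (simp add: inner_diff_left inner_lagrangian_gradient)
qed

text \<open>Sum of the tangent inequalities from \<open>y\<close> to \<open>z\<close> and back; the
  quadratic term contributes \<beta>.\<close>

lemma lagrangian_gradient_strongly_monotone:
  assumes g': "\<And>z. (g has_derivative blinfun_apply (g' z)) (at z)"
    and G': "\<And>z. (G has_derivative blinfun_apply (G' z)) (at z)"
    and conv: "convex_on UNIV (\<lambda>y. g (x, y))" "\<And>i. convex_on UNIV (\<lambda>y. G (x, y) $ i)"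
    and p: "\<And>i. 0 \<le> p $ i"
  shows "\<beta> * (norm (y - z))\<^sup>2
    \<le> (lagrangian_gradient g' G' \<beta> x y p - lagrangian_gradient g' G' \<beta> x z p) \<bullet> (y - z)"
  using lagrangian_gradient_tangent_le[OF g' G' conv p, of y \<beta> z]
    lagrangian_gradient_tangent_le[OF g' G' conv p, of z \<beta> y]
  by (simp add: power2_norm_eq_inner inner_diff_left inner_diff_right inner_commute algebra_simps)

text \<open>Each tangent inequality uses its own solution's multiplier. Adding the monotonicity of
  the subdifferential cancels all values of \<open>g\<close> and \<open>G\<close> and leaves
  \<open>\<beta> |y - z|^2 + \<alpha> |p - q|^2 \<le> 0\<close>.\<close>

lemma sol_set_unique:
  fixes h :: "real ^ 's \<Rightarrow> ereal"
  assumes g': "\<And>z. (g has_derivative blinfun_apply (g' z)) (at z)"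
    and G': "\<And>z. (G has_derivative blinfun_apply (G' z)) (at z)"
    and conv: "convex_on UNIV (\<lambda>y. g (x, y))" "\<And>i. convex_on UNIV (\<lambda>y. G (x, y) $ i)"
    and h: "proper h" "closed {(z, t). h z \<le> ereal t}" "convex {(z, t). h z \<le> ereal t}" "mono h"
    and pos: "\<alpha> > 0" "\<beta> > 0"
    and sol: "(y, p) \<in> sol_set g G h \<alpha> \<beta> x" "(z, q) \<in> sol_set g G h \<alpha> \<beta> x"
  shows "(y, p) = (z, q)"
proof -
  note sol' = sol[unfolded mem_sol_set_iff[OF g' G']]
  have p: "0 \<le> p $ i" and q: "0 \<le> q $ i" for i
    using sol' subdifferential_conjugateD[OF h(1-3)] subgradient_nonneg[OF h(1,4)] by blast+
  have "g (x, y) + G (x, y) \<bullet> p - \<beta> * (y \<bullet> (z - y)) \<le> g (x, z) + G (x, z) \<bullet> p"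
    using lagrangian_gradient_tangent_le[OF g' G' conv p, of y \<beta> z] sol' by simp
  moreover have "g (x, z) + G (x, z) \<bullet> q - \<beta> * (z \<bullet> (y - z)) \<le> g (x, y) + G (x, y) \<bullet> q"
    using lagrangian_gradient_tangent_le[OF g' G' conv q, of z \<beta> y] sol' by simp
  moreover have "0 \<le> (G (x, y) - \<alpha> *\<^sub>R p - (G (x, z) - \<alpha> *\<^sub>R q)) \<bullet> (p - q)"
    using sol' subdifferential_monotone by blast
  ultimately have "\<beta> * (norm (y - z))\<^sup>2 + \<alpha> * (norm (p - q))\<^sup>2 \<le> 0"
    by (simp add: power2_norm_eq_inner inner_diff_left inner_diff_right inner_commute algebra_simps)
  moreover have "0 \<le> \<beta> * (norm (y - z))\<^sup>2" "0 \<le> \<alpha> * (norm (p - q))\<^sup>2"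
    using pos by auto
  ultimately have "\<beta> * (norm (y - z))\<^sup>2 = 0" "\<alpha> * (norm (p - q))\<^sup>2 = 0"
    by linarith+
  then show ?thesis
    using pos by simp
qed

text \<open>Completing the square: half of the quadratic term absorbs the linear one, the other half
  survives for coercivity.\<close>

lemma quadratic_lower_bound:
  fixes b v :: "'a::real_inner"
  assumes "c > 0"
  shows "c / 2 * (norm v)\<^sup>2 - (norm b)\<^sup>2 / (2 * c) \<le> c * (norm v)\<^sup>2 + b \<bullet> v"
proof -
  have "0 \<le> (norm (c *\<^sub>R v + b))\<^sup>2 / (2 * c)"
    using assms by simp
  also have "\<dots> = c / 2 * (norm v)\<^sup>2 + b \<bullet> v + (norm b)\<^sup>2 / (2 * c)"
    using assms by (simp add: power2_norm_eq_inner inner_add_left inner_add_right inner_commute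
        field_simps)
  finally show ?thesis
    by simp
qed

lemma norm_le_of_square_le:
  assumes "(norm v)\<^sup>2 \<le> R"
  shows "norm v \<le> 1 + R"
proof -
  have "0 \<le> (norm v - 1)\<^sup>2"
    by simp
  then have "2 * norm v \<le> 1 + (norm v)\<^sup>2"
    by (simp add: power2_eq_square algebra_simps)
  then show ?thesis
    using assms zero_le_power2[of "norm v"] by linarith
qed

text \<open>
  The solution is found by minimising
  \<open>g (x, y) + \<beta>/2 |y|\<^sup>2 + t + |G (x, y) - w|\<^sup>2 / (2 \<alpha>)\<close> over all \<open>y\<close> and all \<open>(w, t)\<close> in the
  epigraph of \<open>h\<close>: then \<open>p = (G (x, y) - w) / \<alpha>\<close> is a subgradient of \<open>h\<close> at \<open>w\<close>. Coercivity uses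
  an affine minorant of \<open>h\<close>, whose slope is nonnegative as \<open>h\<close> is monotone.
\<close>

lemma sol_set_nonempty:
  fixes h :: "real ^ 's \<Rightarrow> ereal"
  assumes g': "\<And>z. (g has_derivative blinfun_apply (g' z)) (at z)"
    and G': "\<And>z. (G has_derivative blinfun_apply (G' z)) (at z)"
    and conv: "convex_on UNIV (\<lambda>y. g (x, y))" "\<And>i. convex_on UNIV (\<lambda>y. G (x, y) $ i)"
    and h: "proper h" "closed {(z, t). h z \<le> ereal t}" "convex {(z, t). h z \<le> ereal t}" "mono h"
    and pos: "\<alpha> > 0" "\<beta> > 0"
  shows "\<exists>y p. (y, p) \<in> sol_set g G h \<alpha> \<beta> x"
proof -
  define E where "E = {(z, t). h z \<le> ereal t}"
  obtain q c where q: "\<forall>z t. h z \<le> ereal t \<longrightarrow> q \<bullet> z + c \<le> t"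
    using affine_minorant_exists[OF h(1-3)] by metis
  have q0: "0 \<le> q $ i" for i
    using q by (intro affine_minorant_nonneg[OF h(1,4)]) auto
  define J where "J = (\<lambda>(y, w, t). g (x, y) + \<beta> / 2 * (norm y)\<^sup>2 + t + (1 / \<alpha>) / 2 * (norm (G (x, y) - w))\<^sup>2)"
  have contg: "continuous_on UNIV (\<lambda>y. g (x, y))" and contG: "continuous_on UNIV (\<lambda>y. G (x, y))"
    using partial_derivative_right[OF g'] partial_derivative_right[OF G']
    by (meson continuous_at_imp_continuous_on has_derivative_continuous)+
  have contJ: "continuous_on UNIV J"
    unfolding J_def case_prod_unfold
    by (intro continuous_intros continuous_on_compose2[OF contg] continuous_on_compose2[OF contG]) auto
  obtain w0 t0 where wt0: "h w0 = ereal t0"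
    using h(1) unfolding proper_def by (metis real_of_ereal.cases)
  \<comment> \<open>The value at an arbitrary feasible point, so that the sublevel set
    \<open>X\<close> is nonempty.\<close>
  define m where "m = J (0, w0, t0)"
  define X where "X = (UNIV \<times> E) \<inter> {z. J z \<le> m}"
  have closedX: "closed X"
    unfolding X_def E_def
    by (intro closed_Int closed_Times h closed_UNIV closed_Collect_le contJ continuous_on_const)
  \<comment> \<open>\<open>a\<close> and \<open>b\<close> collect the affine terms left after
    bounding \<open>t\<close> below by the minorant and
    \<open>g (x, y) + G (x, y) \<bullet> q\<close> by its tangent at \<open>0\<close>. Completing
    squares in \<open>y\<close> and in \<open>G (x, y) - w\<close> costs the two quotients in
    \<open>R\<close>.\<close>
  define a where "a = g (x, 0) + G (x, 0) \<bullet> q + c - m"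
  define b where "b = lagrangian_gradient g' G' \<beta> x 0 q"
  define R where "R = (norm b)\<^sup>2 / (2 * (\<beta> / 2)) + (norm q)\<^sup>2 / (2 * (1 / \<alpha> / 2)) - a"
  define Ry where "Ry = 1 + R / (\<beta> / 2 / 2)"
  define Rv where "Rv = 1 + R / (1 / \<alpha> / 2 / 2)"
  obtain Rg where Rg: "\<And>y. y \<in> cball 0 Ry \<Longrightarrow> norm (g (x, y)) \<le> Rg"
    using compact_imp_bounded[OF compact_continuous_image[OF continuous_on_subset[OF contg subset_UNIV] compact_cball]]
    unfolding bounded_iff by blast
  obtain RG where RG: "\<And>y. y \<in> cball 0 Ry \<Longrightarrow> norm (G (x, y)) \<le> RG"
    using compact_imp_bounded[OF compact_continuous_image[OF continuous_on_subset[OF contG subset_UNIV] compact_cball]]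
    unfolding bounded_iff by blast
  have "X \<subseteq> cball 0 Ry \<times> cball 0 (RG + Rv) \<times> cball 0 (\<bar>m\<bar> + Rg + \<bar>c\<bar> + norm q * (RG + Rv))"
  proof
    fix z assume "z \<in> X"
    moreover obtain y w t where z: "z = (y, w, t)"
      by (cases z)
    ultimately have E: "h w \<le> ereal t" and J: "J (y, w, t) \<le> m"
      by (auto simp: X_def E_def)
    define v where "v = G (x, y) - w"
    have t: "q \<bullet> w + c \<le> t"
      using q E by blast
    have "g (x, 0) + G (x, 0) \<bullet> q + b \<bullet> y \<le> g (x, y) + G (x, y) \<bullet> q"
      using lagrangian_gradient_tangent_le[OF g' G' conv q0, of 0 \<beta> y] by (simp add: b_def)
    moreover have "G (x, y) \<bullet> q = q \<bullet> w + q \<bullet> v"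
      by (simp add: v_def inner_diff_right inner_commute)
    moreover have J': "g (x, y) + \<beta> / 2 * (norm y)\<^sup>2 + t + (1 / \<alpha>) / 2 * (norm v)\<^sup>2 \<le> m"
      using J by (simp add: J_def v_def)
    ultimately have "(\<beta> / 2 * (norm y)\<^sup>2 + b \<bullet> y) + (1 / \<alpha> / 2 * (norm v)\<^sup>2 + (- q) \<bullet> v) \<le> - a"
      using t by (simp add: a_def)
    then have *: "\<beta> / 2 / 2 * (norm y)\<^sup>2 + 1 / \<alpha> / 2 / 2 * (norm v)\<^sup>2 \<le> R"
      using quadratic_lower_bound[of "\<beta> / 2" y b] quadratic_lower_bound[of "1 / \<alpha> / 2" v "- q"] pos
      by (simp add: R_def)
    have p1: "0 \<le> \<beta> / 2 / 2 * (norm y)\<^sup>2" and p2: "0 \<le> 1 / \<alpha> / 2 / 2 * (norm v)\<^sup>2"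
      using pos by auto
    have "(norm y)\<^sup>2 \<le> R / (\<beta> / 2 / 2)"
      using order_trans[OF _ *, of "\<beta> / 2 / 2 * (norm y)\<^sup>2"] p2 pos by (subst pos_le_divide_eq) (auto simp: mult.commute)
    then have y: "norm y \<le> Ry"
      unfolding Ry_def by (rule norm_le_of_square_le)
    have "(norm v)\<^sup>2 \<le> R / (1 / \<alpha> / 2 / 2)"
      using order_trans[OF _ *, of "1 / \<alpha> / 2 / 2 * (norm v)\<^sup>2"] p1 pos
      by (subst pos_le_divide_eq) (auto simp: mult.commute)
    then have v: "norm v \<le> Rv"
      unfolding Rv_def by (rule norm_le_of_square_le)
    have "w = G (x, y) - v"
      by (simp add: v_def)
    then have "norm w \<le> norm (G (x, y)) + norm v"
      by (metis norm_triangle_ineq4)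
    then have w: "norm w \<le> RG + Rv"
      using RG[of y] y v by auto
    have "\<bar>q \<bullet> w\<bar> \<le> norm q * norm w"
      by (rule Cauchy_Schwarz_ineq2)
    also have "\<dots> \<le> norm q * (RG + Rv)"
      using w by (rule mult_left_mono) simp
    finally have qw: "\<bar>q \<bullet> w\<bar> \<le> norm q * (RG + Rv)" .
    have "0 \<le> \<beta> / 2 * (norm y)\<^sup>2" "0 \<le> 1 / \<alpha> / 2 * (norm v)\<^sup>2"
      using pos by auto
    then have "g (x, y) + t \<le> m"
      using J' by linarith
    moreover have "\<bar>g (x, y)\<bar> \<le> Rg"
      using Rg[of y] y by simp
    \<comment> \<open>The affine minorant bounds \<open>t\<close> below, and
      \<open>J \<le> m\<close> bounds it above.\<close>
    ultimately have "\<bar>t\<bar> \<le> \<bar>m\<bar> + Rg + \<bar>c\<bar> + norm q * (RG + Rv)"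
      using t qw by linarith
    with y w show "z \<in> cball 0 Ry \<times> cball 0 (RG + Rv) \<times> cball 0 (\<bar>m\<bar> + Rg + \<bar>c\<bar> + norm q * (RG + Rv))"
      by (simp add: z)
  qed
  then have "bounded X"
    by (rule bounded_subset[rotated]) (intro bounded_Times bounded_cball)
  with closedX have "compact X"
    using compact_eq_bounded_closed by blast
  moreover have "(0, w0, t0) \<in> X"
    by (simp add: X_def E_def wt0 m_def)
  ultimately obtain y w t where X: "(y, w, t) \<in> X" and min: "\<forall>z\<in>X. J (y, w, t) \<le> J z"
    using continuous_attains_inf[of X J] continuous_on_subset[OF contJ subset_UNIV] by fastforce
  have E: "h w \<le> ereal t"
    using X by (simp add: X_def E_def)
  \<comment> \<open>At feasible points outside \<open>X\<close> the value of \<open>J\<close>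
    exceeds \<open>m\<close>, so the minimum over \<open>X\<close> is a global one.\<close>
  have min: "J (y, w, t) \<le> J (y', w', t')" if "h w' \<le> ereal t'" for y' w' t'
  proof (cases "J (y', w', t') \<le> m")
    case True
    then show ?thesis
      using that min by (auto simp: X_def E_def)
  next
    case False
    then show ?thesis
      using X by (auto simp: X_def)
  qed
  define v where "v = G (x, y) - w"
  define p where "p = (1 / \<alpha>) *\<^sub>R v"
  \<comment> \<open>First-order optimality on the convex epigraph: along the segment towards
    \<open>(z, s)\<close> the objective changes by \<open>l * (A + l * B)\<close>, which is divided
    by \<open>l\<close> before \<open>l\<close> tends to 0.\<close>
  have sub: "t + p \<bullet> (z - w) \<le> s" if zs: "h z \<le> ereal s" for z s
  proof -
    define A where "A = s - t - p \<bullet> (z - w)"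
    define B where "B = 1 / \<alpha> / 2 * (norm (z - w))\<^sup>2"
    have "0 \<le> A + l * B" if l: "0 < l" "l < 1" for l
    proof -
      have "(1 - l) *\<^sub>R (w, t) + l *\<^sub>R (z, s) \<in> {(z, t). h z \<le> ereal t}"
        using l E zs by (intro convexD_alt h) auto
      then have "h (w + l *\<^sub>R (z - w)) \<le> ereal (t + l * (s - t))"
        by (simp add: algebra_simps)
      from min[OF this, of y] have "t + 1 / \<alpha> / 2 * (norm v)\<^sup>2
          \<le> t + l * (s - t) + 1 / \<alpha> / 2 * (norm (v - l *\<^sub>R (z - w)))\<^sup>2"
        by (simp add: J_def v_def algebra_simps)
      also have "\<dots> = t + 1 / \<alpha> / 2 * (norm v)\<^sup>2 + l * (A + l * B)"
      proof -
        have "(norm (v - l *\<^sub>R (z - w)))\<^sup>2 = (norm v)\<^sup>2 - 2 * l * (v \<bullet> (z - w)) + l * l * (norm (z - w))\<^sup>2"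
          by (simp only: power2_norm_eq_inner inner_diff_left[of v] inner_diff_right[of _ v]
              inner_scaleR_left inner_scaleR_right) (simp add: inner_commute[of "z - w" v] right_diff_distrib)
        then show ?thesis
          by (simp only: A_def B_def p_def inner_scaleR_left) (simp add: ring_distribs)
      qed
      finally have "0 \<le> l * (A + l * B)"
        by simp
      then show ?thesis
        using l by (simp add: zero_le_mult_iff)
    qed
    then have "\<forall>\<^sub>F l in at_right 0. 0 \<le> A + l * B"
      by (intro eventually_at_rightI[of 0 1]) auto
    moreover have "((\<lambda>l. A + l * B) \<longlongrightarrow> A + 0 * B) (at_right 0)"
      by (intro tendsto_intros)
    ultimately have "0 \<le> A + 0 * B"
      by (intro tendsto_lowerbound[of _ "A + 0 * B" "at_right (0::real)"]) auto
    then show ?thesis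
      by (simp add: A_def)
  qed
  \<comment> \<open>Choosing \<open>z = w\<close> and \<open>s = h w\<close> in \<open>sub\<close>
    shows that \<open>t\<close> does not lie above the graph.\<close>
  have hw: "h w = ereal t"
  proof (cases "h w")
    case (real r)
    then show ?thesis
      using sub[of w r] E by auto
  qed (use E h(1) in \<open>auto simp: proper_def\<close>)
  have "p \<in> subdifferential h w"
    using mem_subdifferential_iff[of h w t p, OF hw] sub by blast
  then have "w \<in> subdifferential (conjugate h) p"
    by (rule subdifferential_conjugateI)
  moreover have "w = G (x, y) - \<alpha> *\<^sub>R p"
    using pos by (simp add: p_def v_def)
  \<comment> \<open>Optimality in \<open>y\<close> alone; differentiating the penalty term produces
    the multiplier \<open>p\<close>.\<close>
  moreover have "lagrangian_gradient g' G' \<beta> x y p = 0"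
  proof -
    have "((\<lambda>y. J (y, w, t)) has_derivative (\<lambda>d. g' (x, y) (0, d) + \<beta> * (y \<bullet> d) + 0 + 1 / \<alpha> * (v \<bullet> (G' (x, y) (0, d) - 0)))) (at y)"
      unfolding J_def prod.case v_def
      by (intro has_derivative_add has_derivative_half_norm_square has_derivative_ident
          has_derivative_const has_derivative_diff partial_derivative_right g' G')
    then have "(\<lambda>d. g' (x, y) (0, d) + \<beta> * (y \<bullet> d) + 0 + 1 / \<alpha> * (v \<bullet> (G' (x, y) (0, d) - 0))) = (\<lambda>d. 0)"
      by (rule differential_zero_maxmin[of y UNIV, rotated 2]) (use min[OF E] in auto)
    then have "lagrangian_gradient g' G' \<beta> x y p \<bullet> d = 0" for d
      unfolding inner_lagrangian_gradient by (simp add: p_def inner_commute fun_eq_iff algebra_simps)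
    then show ?thesis
      using inner_eq_zero_iff by blast
  qed
  ultimately show ?thesis
    using mem_sol_set_iff[OF g' G'] by metis
qed

section \<open>The implicit function theorem\<close>

text \<open>Supplies continuity of the derivative of a local inverse. \<open>A y0\<close> is bounded
  below by some \<open>c > 0\<close>; once \<open>norm (A y0 - A y) < c / 2\<close>, the error of
  the inverse on the right-hand side is absorbed on the left, which bounds it by a multiple of
  \<open>norm (A y0 - A y)\<close>.\<close>

lemma continuous_on_inv_blinfun:
  fixes A :: "'y::metric_space \<Rightarrow> 'a::euclidean_space \<Rightarrow>\<^sub>L 'b::euclidean_space"
  assumes cont: "continuous_on V A" and bij: "\<And>y. y \<in> V \<Longrightarrow> bij (blinfun_apply (A y))"
  shows "continuous_on V (\<lambda>y. inv (blinfun_apply (A y)) b)"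
  unfolding continuous_on_def
proof
  fix y0 assume y0: "y0 \<in> V"
  have Ainv: "A y (inv (A y) b) = b" if "y \<in> V" for y
    using bij[OF that] by (simp add: bij_is_surj surj_f_inv_f)
  obtain c where c: "c > 0" "\<And>v. c * norm v \<le> norm (A y0 v)"
    using linear_inj_bounded_below_pos[of "A y0"] bij[OF y0] bij_is_inj bounded_linear.linear[OF blinfun.bounded_linear_right] by metis
  define v0 where "v0 = inv (A y0) b"
  have lim: "((\<lambda>y. norm (A y0 - A y)) \<longlongrightarrow> 0) (at y0 within V)"
  proof -
    have "((\<lambda>y. A y0 - A y) \<longlongrightarrow> A y0 - A y0) (at y0 within V)"
      using cont y0 unfolding continuous_on_def by (intro tendsto_diff tendsto_const) auto
    then show ?thesis
      by (intro tendsto_norm_zero) simp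
  qed
  have "((\<lambda>y. inv (A y) b - v0) \<longlongrightarrow> 0) (at y0 within V)"
  proof (rule Lim_null_comparison)
    show "((\<lambda>y. (2 / c) * (norm (A y0 - A y) * norm v0)) \<longlongrightarrow> 0) (at y0 within V)"
      by (intro tendsto_mult_right_zero tendsto_mult_left_zero lim)
    have "\<forall>\<^sub>F y in at y0 within V. norm (A y0 - A y) < c / 2"
      using lim c(1) by (intro order_tendstoD(2)) auto
    moreover have "\<forall>\<^sub>F y in at y0 within V. y \<in> V"
      by (simp add: eventually_at_filter)
    ultimately show "\<forall>\<^sub>F y in at y0 within V. norm (inv (A y) b - v0) \<le> (2 / c) * (norm (A y0 - A y) * norm v0)"
    proof eventually_elim
      case (elim y)
      define d where "d = inv (A y) b - v0"
      have "A y0 d = (A y0 - A y) d + (A y0 - A y) v0"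
        using Ainv[OF elim(2)] Ainv[OF y0] by (simp add: d_def v0_def blinfun.bilinear_simps)
      then have "norm (A y0 d) \<le> norm ((A y0 - A y) d) + norm ((A y0 - A y) v0)"
        by (metis norm_triangle_ineq)
      also have "\<dots> \<le> norm (A y0 - A y) * norm d + norm (A y0 - A y) * norm v0"
        by (intro add_mono norm_blinfun)
      also have "\<dots> \<le> c / 2 * norm d + norm (A y0 - A y) * norm v0"
        using elim(1) by (intro add_mono mult_right_mono) auto
      finally have "c / 2 * norm d \<le> norm (A y0 - A y) * norm v0"
        using c(2)[of d] by simp
      then show ?case
        using c(1) by (simp add: d_def field_simps)
    qed
  qed
  then show "((\<lambda>y. inv (A y) b) \<longlongrightarrow> inv (A y0) b) (at y0 within V)"
    unfolding v0_def by (subst LIM_zero_iff[symmetric])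
qed

text \<open>The map \<open>(x, w) \<mapsto> (x, \<Phi> (x, w))\<close> is inverted locally: its
  derivative is injective because that of \<Phi> in \<open>w\<close> is. Restricting the inverse to
  the points \<open>(x, 0)\<close> gives the branch.\<close>

lemma implicit_function_theorem:
  fixes \<Phi> :: "'x::euclidean_space \<times> 'w::euclidean_space \<Rightarrow> 'w"
  assumes C1: "C1_on UNIV \<Phi>" and zero: "\<Phi> (x0, w0) = 0"
    and der: "(\<Phi> has_derivative D) (at (x0, w0))" and inj: "\<And>w. D (0, w) = 0 \<Longrightarrow> w = 0"
  obtains U s where "open U" "x0 \<in> U" "C1_on U s" "s x0 = w0" "\<And>x. x \<in> U \<Longrightarrow> \<Phi> (x, s x) = 0"
proof -
  define f where "f = (\<lambda>z. (fst z, \<Phi> z))"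
  have "C1_on UNIV f"
    unfolding f_def by (intro C1_on_Pair C1 C1_on_bounded_linear bounded_linear_fst)
  then obtain f' where f': "\<And>z. (f has_derivative blinfun_apply (f' z)) (at z)" "continuous_on UNIV f'"
    unfolding C1_on_def by blast
  have "(f has_derivative (\<lambda>d. (fst d, D d))) (at (x0, w0))"
    unfolding f_def by (intro has_derivative_Pair has_derivative_fst has_derivative_ident der)
  from has_derivative_unique[OF f'(1) this] have f'0: "f' (x0, w0) d = (fst d, D d)" for d
    by metis
  have "inj (f' (x0, w0))"
  proof (subst linear_injective_0)
    show "linear (f' (x0, w0))"
      by (rule bounded_linear.linear[OF blinfun.bounded_linear_right])
    show "\<forall>d. f' (x0, w0) d = 0 \<longrightarrow> d = 0"
      using inj by (auto simp: f'0 zero_prod_def)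
  qed
  then obtain k where k: "linear k" "k \<circ> f' (x0, w0) = id"
    using linear_injective_left_inverse[OF bounded_linear.linear[OF blinfun.bounded_linear_right]] by blast
  have "k (f' (x0, w0) d) = d" for d
    using k(2) by (metis comp_apply id_apply)
  then have "Blinfun k o\<^sub>L f' (x0, w0) = id_blinfun"
    using k(1) by (intro blinfun_eqI) (simp add: linear_conv_bounded_linear bounded_linear_Blinfun_apply)
  then obtain U' V k k' where V: "open V" "f (x0, w0) \<in> V" and U': "(x0, w0) \<in> U'"
    and hom: "homeomorphism U' V f k"
    and derk: "\<And>y. y \<in> V \<Longrightarrow> (k has_derivative k' y) (at y)"
    and k': "\<And>y. y \<in> V \<Longrightarrow> k' y = inv (blinfun_apply (f' (k y)))"
    and bij: "\<And>y. y \<in> V \<Longrightarrow> bij (blinfun_apply (f' (k y)))"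
    using inverse_function_theorem[of UNIV f f' "(x0, w0)"] f' by (metis UNIV_I open_UNIV)
  have contk: "continuous_on V k"
    using hom by (simp add: homeomorphism_def)
  have C1k: "C1_on V k"
  proof (rule C1_onI[OF derk])
    fix b
    have "continuous_on V (\<lambda>y. inv (f' (k y)) b)"
      by (intro continuous_on_inv_blinfun continuous_on_compose2[OF f'(2) contk] bij) auto
    then show "continuous_on V (\<lambda>y. k' y b)"
      by (rule continuous_on_eq) (simp add: k')
  qed
  define U where "U = (\<lambda>x. (x, 0)) -` V"
  define s where "s = (\<lambda>x. snd (k (x, 0)))"
  show thesis
  proof
    show "open U"
      unfolding U_def by (intro open_vimage V continuous_intros)
    show "x0 \<in> U"
      using V(2) zero by (simp add: U_def f_def)
    have "C1_on U (\<lambda>x. k (x, 0))"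
      by (intro C1_on_compose[OF _ C1k] C1_on_bounded_linear)
        (auto simp: U_def intro!: bounded_linear_Pair bounded_linear_ident bounded_linear_zero)
    then show "C1_on U s"
      unfolding s_def
      by (rule C1_on_compose[of U _ UNIV snd, OF _ C1_on_bounded_linear[OF bounded_linear_snd]]) auto
    have "k (f (x0, w0)) = (x0, w0)"
      using hom U' by (rule homeomorphism_apply1)
    then show "s x0 = w0"
      using zero by (simp add: s_def f_def)
    fix x assume "x \<in> U"
    then have "f (k (x, 0)) = (x, 0)"
      using hom by (intro homeomorphism_apply2) (auto simp: U_def)
    then show "\<Phi> (x, s x) = 0"
      by (simp add: s_def f_def) (metis prod.collapse)
  qed
qed

section \<open>Orthogonal projections and derivatives of strongly monotone maps\<close>

lemma orthogonal_projection_exists: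
  fixes S :: "'a::euclidean_space set"
  assumes S: "subspace S"
  obtains P where "bounded_linear P" "\<And>x. P x \<in> S" "\<And>x. x - P x \<in> S\<^sup>\<bottom>"
proof -
  obtain B where B: "B \<subseteq> S" "pairwise orthogonal B" "\<And>x. x \<in> B \<Longrightarrow> norm x = 1"
    "independent B" "span B = S"
    using orthonormal_basis_subspace[OF S] by metis
  have finB: "finite B"
    using B(4) by (rule independent_imp_finite)
  define P where "P = (\<lambda>x. \<Sum>b\<in>B. (x \<bullet> b) *\<^sub>R b)"
  show thesis
  proof
    show "bounded_linear P"
      unfolding P_def by (intro bounded_linear_sum bounded_linear_scaleR_const bounded_linear_inner_left)
    fix x
    show "P x \<in> S"
      unfolding P_def using B(1) S by (intro subspace_sum subspace_scale) auto
    have "orthogonal (x - P x) b" if b: "b \<in> B" for b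
    proof -
      have "P x \<bullet> b = (\<Sum>c\<in>B. if c = b then x \<bullet> b else 0)"
        unfolding P_def inner_sum_left
        using B(2,3) b by (intro sum.cong) (auto simp: pairwise_def orthogonal_def norm_eq_1)
      then show ?thesis
        using b finB by (simp add: orthogonal_def inner_diff_left)
    qed
    then show "x - P x \<in> S\<^sup>\<bottom>"
      using B(5) orthogonal_to_span[of _ B "x - P x"]
      by (auto simp: orthogonal_comp_def orthogonal_commute)
  qed
qed

text \<open>On the line through \<open>y\<close> with direction \<open>d\<close>, subtracting a
  linear function of slope \<open>\<beta> * (norm d)\<^sup>2\<close> from
  \<open>F \<bullet> d\<close> leaves a nondecreasing function, whose derivative at 0 is
  nonnegative.\<close>

lemma derivative_strongly_monotone:
  fixes F :: "'a::real_inner \<Rightarrow> 'a"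
  assumes der: "(F has_derivative F') (at y)"
    and mono: "\<And>y z. \<beta> * (norm (y - z))\<^sup>2 \<le> (F y - F z) \<bullet> (y - z)"
  shows "\<beta> * (norm d)\<^sup>2 \<le> F' d \<bullet> d"
proof -
  define k where "k = (\<lambda>t. F (y + t *\<^sub>R d) \<bullet> d - \<beta> * (norm d)\<^sup>2 * t)"
  have "k t \<le> k s" if "t \<le> s" for t s
  proof (cases "t = s")
    case False
    with that have st: "s - t > 0" by simp
    have "y + s *\<^sub>R d - (y + t *\<^sub>R d) = (s - t) *\<^sub>R d"
      by (simp add: algebra_simps)
    then have "\<beta> * ((s - t) * norm d)\<^sup>2 \<le> (s - t) * ((F (y + s *\<^sub>R d) - F (y + t *\<^sub>R d)) \<bullet> d)"
      using mono[of "y + s *\<^sub>R d" "y + t *\<^sub>R d"] st by simp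
    then have "(s - t) * (\<beta> * (norm d)\<^sup>2 * (s - t)) \<le> (s - t) * ((F (y + s *\<^sub>R d) - F (y + t *\<^sub>R d)) \<bullet> d)"
      by (simp add: power2_eq_square mult_ac)
    then have "\<beta> * (norm d)\<^sup>2 * (s - t) \<le> (F (y + s *\<^sub>R d) - F (y + t *\<^sub>R d)) \<bullet> d"
      using st by simp
    then show ?thesis
      by (simp add: k_def inner_diff_left right_diff_distrib)
  qed simp
  then have "mono_on UNIV k"
    by (simp add: mono_on_def)
  moreover have "((\<lambda>t. F (y + t *\<^sub>R d)) has_derivative (\<lambda>t. F' (t *\<^sub>R d))) (at 0)"
    by (rule has_derivative_compose[where g = F]) (use der in \<open>auto intro!: derivative_eq_intros\<close>)
  then have "(k has_derivative (\<lambda>t. F' (t *\<^sub>R d) \<bullet> d - \<beta> * (norm d)\<^sup>2 * t)) (at 0)"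
    unfolding k_def by (auto intro!: derivative_eq_intros)
  then have "(k has_real_derivative (F' d \<bullet> d - \<beta> * (norm d)\<^sup>2)) (at 0)"
    unfolding has_field_derivative_def
    by (rule has_derivative_eq_rhs)
      (simp add: fun_eq_iff linear_scale[OF has_derivative_linear[OF der]] algebra_simps)
  ultimately show ?thesis
    using mono_on_imp_deriv_nonneg[of UNIV k "F' d \<bullet> d - \<beta> * (norm d)\<^sup>2" 0] by simp
qed

section \<open>Smoothness of the solution map\<close>

lemma C1_on_lagrangian_gradient:
  fixes g' :: "(real ^ 'n) \<times> (real ^ 'm) \<Rightarrow> ((real ^ 'n) \<times> (real ^ 'm)) \<Rightarrow>\<^sub>L real"
    and G' :: "(real ^ 'n) \<times> (real ^ 'm) \<Rightarrow> ((real ^ 'n) \<times> (real ^ 'm)) \<Rightarrow>\<^sub>L (real ^ 's)"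
  assumes g': "C1_on UNIV g'" and G': "C1_on UNIV G'"
  shows "C1_on UNIV (\<lambda>(x, y, p). lagrangian_gradient g' G' \<beta> x y p)"
proof -
  have xy: "C1_on UNIV (\<lambda>z :: (real ^ 'n) \<times> (real ^ 'm) \<times> (real ^ 's). (fst z, fst (snd z)))"
    by (intro C1_on_bounded_linear bounded_linear_intros)
  show ?thesis
    unfolding lagrangian_gradient_def case_prod_unfold
  proof (intro C1_on_add C1_on_bilinear[OF bounded_bilinear_partial_adjoint])
    show "C1_on UNIV (\<lambda>z :: (real ^ 'n) \<times> (real ^ 'm) \<times> (real ^ 's). g' (fst z, fst (snd z)))"
      by (rule C1_on_compose[OF xy g']) simp
    show "C1_on UNIV (\<lambda>z :: (real ^ 'n) \<times> (real ^ 'm) \<times> (real ^ 's). G' (fst z, fst (snd z)))"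
      by (rule C1_on_compose[OF xy G']) simp
    show "C1_on UNIV (\<lambda>z :: (real ^ 'n) \<times> (real ^ 'm) \<times> (real ^ 's). \<beta> *\<^sub>R fst (snd z))"
      "C1_on UNIV (\<lambda>z :: (real ^ 'n) \<times> (real ^ 'm) \<times> (real ^ 's). snd (snd z))"
      by (intro C1_on_bounded_linear bounded_linear_intros)+
    show "C1_on UNIV (\<lambda>z :: (real ^ 'n) \<times> (real ^ 'm) \<times> (real ^ 's). 1 :: real)"
      by (rule C1_onI[where D = "\<lambda>_ _. 0"]) auto
  qed
qed

lemma lagrangian_gradient_partial_derivatives:
  assumes "((\<lambda>(x, y, p). lagrangian_gradient g' G' \<beta> x y p) has_derivative L') (at (x, y, p))"
  shows "((\<lambda>x. lagrangian_gradient g' G' \<beta> x y p) has_derivative (\<lambda>d. L' (d, 0, 0))) (at x)"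
    and "((\<lambda>y. lagrangian_gradient g' G' \<beta> x y p) has_derivative (\<lambda>d. L' (0, d, 0))) (at y)"
    and "L' (0, 0, q) = partial_adjoint (G' (x, y)) q"
proof -
  let ?F = "\<lambda>(x, y, p). lagrangian_gradient g' G' \<beta> x y p"
  show "((\<lambda>x. lagrangian_gradient g' G' \<beta> x y p) has_derivative (\<lambda>d. L' (d, 0, 0))) (at x)"
    using has_derivative_compose[of "\<lambda>x. (x, y, p)" "\<lambda>d. (d, 0, 0)" x UNIV ?F L', OF _ assms]
    by (simp add: has_derivative_Pair)
  show "((\<lambda>y. lagrangian_gradient g' G' \<beta> x y p) has_derivative (\<lambda>d. L' (0, d, 0))) (at y)"
    using has_derivative_compose[of "\<lambda>y. (x, y, p)" "\<lambda>d. (0, d, 0)" y UNIV ?F L', OF _ assms]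
    by (simp add: has_derivative_Pair)
  have "((\<lambda>p. lagrangian_gradient g' G' \<beta> x y p) has_derivative (\<lambda>d. L' (0, 0, d))) (at p)"
    using has_derivative_compose[of "\<lambda>p. (x, y, p)" "\<lambda>d. (0, 0, d)" p UNIV ?F L', OF _ assms]
    by (simp add: has_derivative_Pair)
  moreover have "((\<lambda>p. lagrangian_gradient g' G' \<beta> x y p) has_derivative (\<lambda>d. 0 + partial_adjoint (G' (x, y)) d + 0)) (at p)"
    unfolding lagrangian_gradient_def
    by (intro has_derivative_add has_derivative_const bounded_linear_imp_has_derivative
        bounded_bilinear.bounded_linear_right[OF bounded_bilinear_partial_adjoint])
  ultimately have "(\<lambda>d. L' (0, 0, d)) = (\<lambda>d. 0 + partial_adjoint (G' (x, y)) d + 0)"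
    by (rule has_derivative_unique)
  from fun_cong[OF this, of q] show "L' (0, 0, q) = partial_adjoint (G' (x, y)) q"
    by simp
qed

text \<open>The first equation is paired with \<open>d\<close>, the residual with \<open>q\<close>.
  The latter turns the coupling term \<open>G' (x, y) (0, d) \<bullet> q\<close> into
  \<open>\<alpha> * (norm q)\<^sup>2\<close>, so the two squares, with positive weights, have a sum
  at most 0.\<close>

lemma reduced_system_injective:
  assumes g': "\<And>z. (g has_derivative blinfun_apply (g' z)) (at z)"
    and G': "\<And>z. (G has_derivative blinfun_apply (G' z)) (at z)"
    and conv: "convex_on UNIV (\<lambda>y. g (x, y))" "\<And>i. convex_on UNIV (\<lambda>y. G (x, y) $ i)"
    and p: "\<And>i. 0 \<le> p $ i" and pos: "\<alpha> > 0" "\<beta> > 0"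
    and L': "((\<lambda>(x, y, p). lagrangian_gradient g' G' \<beta> x y p) has_derivative L') (at (x, y, p))"
    and zero: "L' (0, d, q) = 0" "q \<in> K" "G' (x, y) (0, d) - \<alpha> *\<^sub>R q \<in> K\<^sup>\<bottom>"
  shows "d = 0 \<and> q = 0"
proof -
  have "\<beta> * (norm d)\<^sup>2 \<le> L' (0, d, 0) \<bullet> d"
    by (rule derivative_strongly_monotone[OF lagrangian_gradient_partial_derivatives(2)[OF L']])
      (rule lagrangian_gradient_strongly_monotone[OF g' G' conv p])
  moreover have "(L' (0, d, 0) + L' (0, 0, q)) \<bullet> d = 0"
    using linear_add[OF has_derivative_linear[OF L'], of "(0, d, 0)" "(0, 0, q)"] zero(1) by simp
  then have "L' (0, d, 0) \<bullet> d + G' (x, y) (0, d) \<bullet> q = 0"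
    unfolding lagrangian_gradient_partial_derivatives(3)[OF L'] inner_add_left inner_partial_adjoint .
  moreover have "q \<bullet> (G' (x, y) (0, d) - \<alpha> *\<^sub>R q) = 0"
    using zero(2,3) by (auto simp: orthogonal_comp_def orthogonal_def)
  then have "G' (x, y) (0, d) \<bullet> q = \<alpha> * (norm q)\<^sup>2"
    by (simp add: inner_diff_right power2_norm_eq_inner inner_commute[of q "blinfun_apply _ _"])
  ultimately have "\<beta> * (norm d)\<^sup>2 + \<alpha> * (norm q)\<^sup>2 \<le> 0"
    by simp
  moreover have "0 \<le> \<beta> * (norm d)\<^sup>2" "0 \<le> \<alpha> * (norm q)\<^sup>2"
    using pos by auto
  ultimately have "\<beta> * (norm d)\<^sup>2 = 0" "\<alpha> * (norm q)\<^sup>2 = 0"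
    by linarith+
  then show ?thesis
    using pos by simp
qed

lemma sol_mapI:
  fixes h :: "real ^ 's \<Rightarrow> ereal"
  assumes "\<And>z. (g has_derivative blinfun_apply (g' z)) (at z)"
    and "\<And>z. (G has_derivative blinfun_apply (G' z)) (at z)"
    and "convex_on UNIV (\<lambda>y. g (x, y))" "\<And>i. convex_on UNIV (\<lambda>y. G (x, y) $ i)"
    and "proper h" "closed {(z, t). h z \<le> ereal t}" "convex {(z, t). h z \<le> ereal t}" "mono h"
    and "\<alpha> > 0" "\<beta> > 0"
    and "s \<in> sol_set g G h \<alpha> \<beta> x"
  shows "sol_map g G h \<alpha> \<beta> x = s"
  unfolding sol_map_def
proof (rule the_equality)
  fix t assume "t \<in> sol_set g G h \<alpha> \<beta> x"
  then show "t = s"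
    using sol_set_unique[OF assms(1-10), of "fst t" "snd t" "fst s" "snd s"] assms(11) by simp
qed (rule assms(11))

lemma add_eq_0_orthogonal_comp:
  assumes "a + b = 0" "a \<in> K" "b \<in> K\<^sup>\<bottom>"
  shows "a = 0 \<and> b = 0"
proof -
  have "a \<bullet> b = 0"
    using assms by (auto simp: orthogonal_comp_def orthogonal_def)
  moreover have "b = - a"
    using assms(1) by (simp add: add_eq_0_iff)
  ultimately show ?thesis
    by simp
qed

text \<open>
  Near the reference point the inclusion \<open>G (x, y) - \<alpha> p \<in> \<partial>h\<^sup>* (p)\<close> reduces to the affine
  equations \<open>p - pbar \<in> K\<close> and \<open>G (x, y) - \<alpha> p - ubar \<in> K\<^sup>\<bottom>\<close>. With the orthogonal projection
  \<open>P\<close> onto \<open>K\<close> both are encoded in the single equation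
  \<open>P (G (x, y) - \<alpha> p - ubar) + (p - pbar - P (p - pbar)) = 0\<close>.
\<close>

lemma sol_map_C1:
  fixes g :: "(real ^ 'n) \<times> (real ^ 'm) \<Rightarrow> real"
    and g' :: "(real ^ 'n) \<times> (real ^ 'm) \<Rightarrow> ((real ^ 'n) \<times> (real ^ 'm)) \<Rightarrow>\<^sub>L real"
    and G :: "(real ^ 'n) \<times> (real ^ 'm) \<Rightarrow> real ^ 's"
    and G' :: "(real ^ 'n) \<times> (real ^ 'm) \<Rightarrow> ((real ^ 'n) \<times> (real ^ 'm)) \<Rightarrow>\<^sub>L (real ^ 's)"
    and h :: "real ^ 's \<Rightarrow> ereal"
  assumes g': "\<And>z. (g has_derivative blinfun_apply (g' z)) (at z)" "C1_on UNIV g'"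
    and G': "\<And>z. (G has_derivative blinfun_apply (G' z)) (at z)" "C1_on UNIV G'" "C1_on UNIV G"
    and conv: "\<And>x. convex_on UNIV (\<lambda>y. g (x, y))" "\<And>x i. convex_on UNIV (\<lambda>y. G (x, y) $ i)"
    and h: "proper h" "epi_polyhedral h" "mono h"
    and pos: "\<alpha> > 0" "\<beta> > 0"
    and sol: "(ybar, pbar) \<in> sol_set g G h \<alpha> \<beta> xbar"
    and ri: "G (xbar, ybar) - \<alpha> *\<^sub>R pbar \<in> rel_interior (subdifferential (conjugate h) pbar)"
    and L': "((\<lambda>(x, y, p). lagrangian_gradient g' G' \<beta> x y p) has_derivative L') (at (xbar, ybar, pbar))"
  defines "K \<equiv> critical_cone (conjugate h) pbar (G (xbar, ybar) - \<alpha> *\<^sub>R pbar)"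
  obtains U S' where "open U" "xbar \<in> U" "C1_on U (sol_map g G h \<alpha> \<beta>)"
    "(sol_map g G h \<alpha> \<beta> has_derivative S') (at xbar)"
    "\<And>d. snd (S' d) \<in> K" "\<And>d. L' (d, S' d) = 0"
    "\<And>d. G' (xbar, ybar) (d, fst (S' d)) - \<alpha> *\<^sub>R snd (S' d) \<in> K\<^sup>\<bottom>"
proof -
  have hE: "closed {(z, t). h z \<le> ereal t}" "convex {(z, t). h z \<le> ereal t}"
    using h(2) polyhedron_imp_closed polyhedron_imp_convex by (auto simp: epi_polyhedral_def)
  define ubar where "ubar = G (xbar, ybar) - \<alpha> *\<^sub>R pbar"
  have subK: "subspace K"
    unfolding K_def critical_cone_def normal_cone_rel_interior[OF ri]
    by (rule subspace_orthogonal_comp)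
  obtain \<delta> where \<delta>: "\<delta> > 0" "\<And>v w. v \<in> K \<Longrightarrow> w \<in> K\<^sup>\<bottom> \<Longrightarrow> norm v < \<delta> \<Longrightarrow> norm w < \<delta>
      \<Longrightarrow> ubar + w \<in> subdifferential (conjugate h) (pbar + v)"
    using epi_polyhedral_subdifferential_stable[OF h(1,2) ri] unfolding K_def ubar_def by metis
  obtain P where P: "bounded_linear P" "\<And>q. P q \<in> K" "\<And>q. q - P q \<in> K\<^sup>\<bottom>"
    using orthogonal_projection_exists[OF subK] by metis
  interpret P: bounded_linear P by (rule P(1))
  have P0: "q \<in> K\<^sup>\<bottom>" if "P q = 0" for q
    using P(3)[of q] that by simp
  have P1: "q \<in> K" if "q - P q = 0" for q
    using P(2)[of q] that by simp
  define u where "u = (\<lambda>(x, y, p). G (x, y) - \<alpha> *\<^sub>R p)"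
  define \<Phi> where "\<Phi> = (\<lambda>z. (case z of (x, y, p) \<Rightarrow> lagrangian_gradient g' G' \<beta> x y p,
      P (u z - ubar) + (snd (snd z) - pbar - P (snd (snd z) - pbar))))"
  define D where "D = (\<lambda>d. (L' d,
      P (G' (xbar, ybar) (fst d, fst (snd d)) - \<alpha> *\<^sub>R snd (snd d)) + (snd (snd d) - P (snd (snd d)))))"
  have sol': "lagrangian_gradient g' G' \<beta> xbar ybar pbar = 0" "ubar \<in> subdifferential (conjugate h) pbar"
    using sol by (simp_all add: mem_sol_set_iff[OF g'(1) G'(1)] ubar_def)
  have pbar0: "0 \<le> pbar $ i" for i
    using subdifferential_conjugateD[OF h(1) hE sol'(2)] by (rule subgradient_nonneg[OF h(1,3)])
  have C1u: "C1_on UNIV u"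
  proof -
    have "C1_on UNIV (\<lambda>z :: (real ^ 'n) \<times> (real ^ 'm) \<times> (real ^ 's). (fst z, fst (snd z)))"
      by (intro C1_on_bounded_linear bounded_linear_intros)
    then have "C1_on UNIV (\<lambda>z :: (real ^ 'n) \<times> (real ^ 'm) \<times> (real ^ 's). G (fst z, fst (snd z)) + (- \<alpha>) *\<^sub>R snd (snd z))"
      by (intro C1_on_add C1_on_bounded_linear bounded_linear_intros C1_on_compose[OF _ G'(3)]) auto
    then show ?thesis
      by (simp add: u_def case_prod_unfold)
  qed
  have C1_const: "C1_on UNIV (\<lambda>z :: (real ^ 'n) \<times> (real ^ 'm) \<times> (real ^ 's). c)" for c :: "real ^ 's"
    by (rule C1_onI[where D = "\<lambda>_ _. 0"]) auto
  have C1\<Phi>: "C1_on UNIV \<Phi>"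
  proof -
    have "C1_on UNIV (\<lambda>z. P (u z + (- ubar)))"
      by (intro C1_on_compose[OF _ C1_on_bounded_linear[OF P(1), of UNIV]] C1_on_add C1u C1_const) simp
    moreover have "C1_on UNIV (\<lambda>z :: (real ^ 'n) \<times> (real ^ 'm) \<times> (real ^ 's). (snd (snd z) - P (snd (snd z))) + (P pbar - pbar))"
      by (intro C1_on_add C1_const C1_on_bounded_linear bounded_linear_intros bounded_linear_compose[OF P(1)])
    ultimately have "C1_on UNIV (\<lambda>z. P (u z + (- ubar)) + ((snd (snd z) - P (snd (snd z))) + (P pbar - pbar)))"
      by (rule C1_on_add)
    then show ?thesis
      unfolding \<Phi>_def
      by (intro C1_on_Pair C1_on_lagrangian_gradient g' G') (simp add: P.diff algebra_simps)
  qed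
  have \<Phi>bar: "\<Phi> (xbar, ybar, pbar) = 0"
    by (simp add: \<Phi>_def u_def ubar_def sol' P.zero zero_prod_def)
  have D: "(\<Phi> has_derivative D) (at (xbar, ybar, pbar))"
  proof -
    have "(u has_derivative (\<lambda>d. G' (xbar, ybar) (fst d, fst (snd d)) - \<alpha> *\<^sub>R snd (snd d))) (at (xbar, ybar, pbar))"
      unfolding u_def case_prod_unfold
    proof (intro has_derivative_diff)
      show "((\<lambda>z. G (fst z, fst (snd z))) has_derivative (\<lambda>d. G' (xbar, ybar) (fst d, fst (snd d)))) (at (xbar, ybar, pbar))"
        by (rule has_derivative_compose[where g = G]) (use G'(1) in \<open>auto intro!: derivative_eq_intros\<close>)
    qed (auto intro!: derivative_eq_intros)
    then have uD: "((\<lambda>z. u z - ubar) has_derivative (\<lambda>d. G' (xbar, ybar) (fst d, fst (snd d)) - \<alpha> *\<^sub>R snd (snd d) - 0)) (at (xbar, ybar, pbar))"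
      by (intro has_derivative_diff has_derivative_const)
    have qD: "((\<lambda>z. snd (snd z) - pbar) has_derivative (\<lambda>d. snd (snd d) - 0)) (at (xbar, ybar, pbar))"
      by (auto intro!: derivative_eq_intros)
    have "(\<Phi> has_derivative (\<lambda>d. (L' d, P (G' (xbar, ybar) (fst d, fst (snd d)) - \<alpha> *\<^sub>R snd (snd d) - 0)
        + (snd (snd d) - 0 - P (snd (snd d) - 0))))) (at (xbar, ybar, pbar))"
      unfolding \<Phi>_def
      by (intro has_derivative_Pair L' has_derivative_add P.has_derivative[OF uD]
          has_derivative_diff[OF qD P.has_derivative[OF qD]])
    then show ?thesis
      by (simp add: D_def)
  qed
  \<comment> \<open>The two summands of the second component lie in \<open>K\<close> and in its
    orthogonal complement, so each vanishes and one equation yields both linearised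
    inclusions.\<close>
  have zeroD: "L' d = 0 \<and> snd (snd d) \<in> K \<and> G' (xbar, ybar) (fst d, fst (snd d)) - \<alpha> *\<^sub>R snd (snd d) \<in> K\<^sup>\<bottom>"
    if "D d = 0" for d
  proof -
    from that have 1: "L' d = 0"
      and 2: "P (G' (xbar, ybar) (fst d, fst (snd d)) - \<alpha> *\<^sub>R snd (snd d)) + (snd (snd d) - P (snd (snd d))) = 0"
      by (simp_all add: D_def zero_prod_def)
    from add_eq_0_orthogonal_comp[OF 2 P(2) P(3)] show ?thesis
      using 1 P0 P1 by blast
  qed
  have inj: "w = 0" if "D (0, w) = 0" for w
  proof -
    have "fst w = 0 \<and> snd w = 0"
      using zeroD[OF that]
      by (intro reduced_system_injective[OF g'(1) G'(1) conv pbar0 pos L', of _ _ K]) auto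
    then show ?thesis
      by (simp add: prod_eq_iff)
  qed
  obtain U s where U: "open U" "xbar \<in> U" and C1s: "C1_on U s" and s0: "s xbar = (ybar, pbar)"
    and \<Phi>0: "\<And>x. x \<in> U \<Longrightarrow> \<Phi> (x, s x) = 0"
    using implicit_function_theorem[OF C1\<Phi> \<Phi>bar D inj] by metis
  have conts: "continuous_on U s"
    by (rule C1_on_imp_continuous_on[OF C1s])
  have contu: "continuous_on U (\<lambda>x. u (x, s x))"
    by (intro continuous_on_compose2[OF C1_on_imp_continuous_on[OF C1u]] continuous_intros conts) auto
  \<comment> \<open>Here the branch stays within the radius \<delta> on which the affine set lies in
    the graph of the subdifferential.\<close>
  define W where "W = {x \<in> U. norm (snd (s x) - pbar) < \<delta> \<and> norm (u (x, s x) - ubar) < \<delta>}"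
  have "W = (U \<inter> (\<lambda>x. norm (snd (s x) - pbar)) -` {..<\<delta>}) \<inter> (U \<inter> (\<lambda>x. norm (u (x, s x) - ubar)) -` {..<\<delta>})"
    by (auto simp: W_def)
  moreover have "open \<dots>"
    by (intro open_Int continuous_open_preimage U(1) open_lessThan continuous_intros conts contu)
  ultimately have openW: "open W"
    by simp
  have xW: "xbar \<in> W"
    using U(2) \<delta>(1) by (simp add: W_def s0 u_def ubar_def)
  \<comment> \<open>A zero of \<Phi> satisfies the affine inclusions, stability turns these into the
    original inclusion, and uniqueness identifies the branch with the solution map.\<close>
  have sol_s: "sol_map g G h \<alpha> \<beta> x = s x" if x: "x \<in> W" for x
  proof (rule sol_mapI[OF g'(1) G'(1) conv h(1) hE h(3) pos])
    obtain y p where s: "s x = (y, p)" by (cases "s x")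
    have z: "lagrangian_gradient g' G' \<beta> x y p = 0"
      "P (u (x, y, p) - ubar) + (p - pbar - P (p - pbar)) = 0"
      using \<Phi>0[of x] x by (simp_all add: W_def s \<Phi>_def zero_prod_def)
    have "P (u (x, y, p) - ubar) = 0 \<and> p - pbar - P (p - pbar) = 0"
      using z(2) P(2,3) by (rule add_eq_0_orthogonal_comp)
    then have "u (x, y, p) - ubar \<in> K\<^sup>\<bottom>" "p - pbar \<in> K"
      using P0 P1 by blast+
    then have "ubar + (u (x, y, p) - ubar) \<in> subdifferential (conjugate h) (pbar + (p - pbar))"
      using x by (intro \<delta>(2)) (auto simp: W_def s)
    then show "s x \<in> sol_set g G h \<alpha> \<beta> x"
      using z(1) by (simp add: s mem_sol_set_iff[OF g'(1) G'(1)] u_def)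
  qed
  obtain s' where s': "\<And>x. x \<in> U \<Longrightarrow> (s has_derivative s' x) (at x)" "\<And>v. continuous_on U (\<lambda>x. s' x v)"
    using C1_onE[OF C1s] by metis
  have der: "(sol_map g G h \<alpha> \<beta> has_derivative s' x) (at x)" if "x \<in> W" for x
  proof (rule has_derivative_transform_within_open[OF s'(1) openW that])
    show "x \<in> U"
      using that by (simp add: W_def)
    show "s x = sol_map g G h \<alpha> \<beta> x" if "x \<in> W" for x
      using sol_s[OF that] by simp
  qed
  \<comment> \<open>Differentiating the identity \<open>\<Phi> (x, s x) = 0\<close> puts
    \<open>(d, s' xbar d)\<close> into the kernel of \<open>D\<close>; this yields the three
    conditions on the derivative.\<close>
  have "((\<lambda>x. \<Phi> (x, s x)) has_derivative (\<lambda>d. D (d, s' xbar d))) (at xbar)"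
    by (rule has_derivative_compose[where g = \<Phi>])
      (use D s'(1)[OF U(2)] in \<open>auto simp: s0 intro!: has_derivative_Pair has_derivative_ident\<close>)
  moreover have "((\<lambda>x. \<Phi> (x, s x)) has_derivative (\<lambda>d. 0)) (at xbar)"
    by (rule has_derivative_transform_within_open[OF has_derivative_const U]) (simp add: \<Phi>0)
  ultimately have "(\<lambda>d. D (d, s' xbar d)) = (\<lambda>d. 0)"
    by (rule has_derivative_unique)
  then have D0: "D (d, s' xbar d) = 0" for d
    by metis
  show thesis
  proof
    show "C1_on W (sol_map g G h \<alpha> \<beta>)"
    proof (rule C1_onI[OF der])
      show "continuous_on W (\<lambda>x. s' x b)" for b
        by (rule continuous_on_subset[OF s'(2)]) (auto simp: W_def)
    qed
    show "(sol_map g G h \<alpha> \<beta> has_derivative s' xbar) (at xbar)"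
      by (rule der[OF xW])
    fix d
    show "snd (s' xbar d) \<in> K" "L' (d, s' xbar d) = 0"
      "G' (xbar, ybar) (d, fst (s' xbar d)) - \<alpha> *\<^sub>R snd (s' xbar d) \<in> K\<^sup>\<bottom>"
      using zeroD[OF D0[of d]] by simp_all
  qed (rule openW xW)+
qed

section \<open>The reduced linear system\<close>

lemma sum_UNIV_Plus:
  fixes f :: "'a::finite + 'b::finite \<Rightarrow> 'c::comm_monoid_add"
  shows "sum f UNIV = (\<Sum>a\<in>UNIV. f (Inl a)) + (\<Sum>b\<in>UNIV. f (Inr b))"
  by (simp add: sum.Plus comp_def flip: UNIV_Plus_UNIV)

lemma vstack_add: "vstack a b + vstack c d = vstack (a + c) (b + d)"
  by (simp add: vstack_def vec_eq_iff split_sum_all)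

lemma vstack_inner: "vstack a b \<bullet> vstack c d = a \<bullet> c + b \<bullet> d"
  by (simp add: inner_vec_def vstack_def sum_UNIV_Plus)

lemma vstack_mult_vec: "vstack M N *v x = vstack (M *v x) (N *v x)"
  by (simp add: vstack_def vec_eq_iff split_sum_all matrix_vector_mult_def)

lemma hstack_mult_vstack: "hstack M N *v vstack a b = M *v a + N *v b"
  by (simp add: hstack_def vstack_def vec_eq_iff matrix_vector_mult_def sum_UNIV_Plus)

lemma bounded_linear_vstack:
  "bounded_linear (\<lambda>(y :: real ^ 'm, p :: real ^ 's). vstack y p)"
  unfolding case_prod_unfold linear_conv_bounded_linear[symmetric]
  by (rule linearI) (auto simp: vstack_def vec_eq_iff split_sum_all)

lemma range_eq_span_columns:
  fixes B :: "real ^ 'k ^ 'd"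
  shows "range ((*v) B) = span (columns B)"
proof
  show "span (columns B) \<subseteq> range ((*v) B)"
    by (rule span_minimal)
      (auto simp: columns_image_basis intro: linear_subspace_image matrix_vector_mul_linear)
qed (auto simp: matrix_vector_mult_in_columnspace)

lemma columns_form_basis_injective:
  fixes B :: "real ^ 'k ^ 'd"
  assumes "columns_form_basis B V" and "B *v c = 0"
  shows "c = 0"
proof -
  have inj: "inj (\<lambda>j. column j B)" and ind: "independent (columns B)"
    using assms(1) by (auto simp: columns_form_basis_def)
  have cols: "columns B = range (\<lambda>j. column j B)"
    by (auto simp: columns_def)
  \<comment> \<open>Distinct columns let each coefficient be read off from the column itself, so
    independence of the set of columns applies to \<open>c\<close>.\<close>
  define a where "a = (\<lambda>v. c $ inv (\<lambda>j. column j B) v)"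
  have "(\<Sum>v\<in>columns B. a v *\<^sub>R v) = (\<Sum>j\<in>UNIV. c $ j *\<^sub>R column j B)"
    unfolding cols by (subst sum.reindex[OF inj]) (simp add: a_def inv_f_f[OF inj])
  also have "\<dots> = 0"
    using assms(2) by (simp add: matrix_mult_sum scalar_mult_eq_scaleR)
  finally have "a (column j B) = 0" for j
    using independentD[OF ind, of "columns B" a] by (auto simp: cols)
  then show ?thesis
    by (simp add: a_def inv_f_f[OF inj] vec_eq_iff)
qed

text \<open>With \<open>conjugate h p\<close> finite, the terms in \<open>p\<close> alone are real
  constants in \<open>y\<close> and drop out.\<close>

lemma grad_y_lagrangian_eq:
  assumes g': "\<And>z. (g has_derivative blinfun_apply (g' z)) (at z)"
    and G': "\<And>z. (G has_derivative blinfun_apply (G' z)) (at z)"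
    and fin: "\<bar>conjugate h p\<bar> \<noteq> \<infinity>"
  shows "grad_y_lagrangian g G h \<alpha> \<beta> x y p = lagrangian_gradient g' G' \<beta> x y p"
proof -
  obtain c where c: "conjugate h p = ereal c"
    using fin by (cases "conjugate h p") auto
  have "((\<lambda>y. g (x, y) + \<beta> / 2 * (norm y)\<^sup>2 + G (x, y) \<bullet> p - (c + \<alpha> / 2 * (norm p)\<^sup>2)) has_derivative
           (\<lambda>d. lagrangian_gradient g' G' \<beta> x y p \<bullet> d - 0)) (at y)"
    by (intro has_derivative_diff has_derivative_quadratic_lagrangian g' G' has_derivative_const)
  then show ?thesis
    unfolding grad_y_lagrangian_def lagrangian_def c
    by (intro gradient_eqI) (simp add: algebra_simps)
qed

lemma matrix_inv_left:
  fixes M :: "'a::semiring_1 ^ 'n ^ 'n"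
  assumes "invertible M"
  shows "matrix_inv M ** M = mat 1"
  using someI_ex[OF assms[unfolded invertible_def]] by (simp add: matrix_inv_def)

text \<open>
  A derivative \<open>S'\<close> of the solution map lies in the range of \<open>B\<close> and has a residual orthogonal to
  that range; these two properties determine it.
\<close>

lemma reduced_linear_system:
  fixes A :: "real ^ 'd ^ 'd" and B :: "real ^ 'k ^ 'd" and X :: "real ^ 'n ^ 'd"
  assumes B: "columns_form_basis B V"
    and inj: "\<And>v. v \<in> V \<Longrightarrow> (\<And>w. w \<in> V \<Longrightarrow> w \<bullet> (A *v v) = 0) \<Longrightarrow> v = 0"
    and S: "\<And>d. S *v d \<in> V" "\<And>d w. w \<in> V \<Longrightarrow> w \<bullet> (X *v d + A *v (S *v d)) = 0"
  defines "M \<equiv> transpose B ** A ** B"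
  shows "invertible M \<and> S = - (B ** matrix_inv M ** transpose B ** X)"
proof -
  have V: "V = range ((*v) B)"
    using B range_eq_span_columns by (auto simp: columns_form_basis_def)
  have adj: "(B *v c) \<bullet> z = c \<bullet> (transpose B *v z)" for c z
    by (simp add: transpose_matrix_vector inner_commute[of "B *v c"] inner_commute[of c] dot_lmul_matrix)
  have M: "M *v c = transpose B *v (A *v (B *v c))" for c
    by (simp add: M_def matrix_vector_mul_assoc matrix_mul_assoc)
  \<comment> \<open>\<open>M *v c = 0\<close> says that \<open>A *v (B *v c)\<close> is orthogonal
    to all of \<open>V\<close>, and \<open>B *v c\<close> itself lies in \<open>V\<close>, so
    \<open>inj\<close> applies.\<close>
  have "c = 0" if "M *v c = 0" for c
  proof -
    have "w \<bullet> (A *v (B *v c)) = 0" if "w \<in> V" for w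
      using that \<open>M *v c = 0\<close> M by (auto simp: V adj)
    then have "B *v c = 0"
      by (intro inj) (auto simp: V)
    then show ?thesis
      by (rule columns_form_basis_injective[OF B])
  qed
  then have inv: "invertible M"
    by (simp add: invertible_left_inverse matrix_left_invertible_ker)
  have "S *v d = - (B ** matrix_inv M ** transpose B ** X) *v d" for d
  proof -
    obtain c where c: "S *v d = B *v c"
      using S(1)[of d] by (auto simp: V)
    \<comment> \<open>The residual is orthogonal to \<open>B *v r\<close>, an element of
      \<open>V\<close>; moving \<open>B\<close> to the other side gives
      \<open>r \<bullet> r = 0\<close>.\<close>
    define r where "r = transpose B *v (X *v d + A *v (S *v d))"
    have "r \<bullet> r = 0"
      unfolding r_def using S(2)[of "B *v r" d] by (simp add: V adj r_def)
    then have "transpose B *v (X *v d) + M *v c = 0"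
      by (simp add: r_def M c matrix_vector_right_distrib)
    then have "M *v c = - (transpose B *v (X *v d))"
      by (simp add: add_eq_0_iff add.commute)
    then have "matrix_inv M *v (M *v c) = - (matrix_inv M *v (transpose B *v (X *v d)))"
      by (simp add: linear_neg[OF matrix_vector_mul_linear])
    then have "c = - (matrix_inv M *v (transpose B *v (X *v d)))"
      using inv by (simp add: matrix_vector_mul_assoc[of _ M] matrix_inv_left)
    then show ?thesis
      using matrix_vector_mult_diff_rdistrib[of 0 "B ** matrix_inv M ** transpose B ** X" d]
      by (simp add: c linear_neg[OF matrix_vector_mul_linear] matrix_vector_mul_assoc matrix_mul_assoc)
  qed
  then have "S = - (B ** matrix_inv M ** transpose B ** X)"
    by (simp add: matrix_eq)
  with inv show ?thesis ..
qed

theorem theorem3p2: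
  fixes g :: "(real ^ 'n) \<times> (real ^ 'm) \<Rightarrow> real"
    and G :: "(real ^ 'n) \<times> (real ^ 'm) \<Rightarrow> real ^ 's"
    and h :: "real ^ 's \<Rightarrow> ereal"
    and \<alpha> \<beta> :: real
    and xbar :: "real ^ 'n" and ybar :: "real ^ 'm" and pbar :: "real ^ 's"
  assumes "C2 g" and "C2 G"
    and "\<And>x. convex_on UNIV (\<lambda>y. g (x, y))"
    and "\<And>x i. convex_on UNIV (\<lambda>y. G (x, y) $ i)"
    and "proper h" and "epi_polyhedral h" and "mono h"
    and "\<alpha> > 0" and "\<beta> > 0"
    and "(ybar, pbar) = sol_map g G h \<alpha> \<beta> xbar"
    and "G (xbar, ybar) - \<alpha> *\<^sub>R pbar \<in> rel_interior (subdifferential (conjugate h) pbar)"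
  shows "(\<exists>U. open U \<and> xbar \<in> U \<and> C1_on U (sol_map g G h \<alpha> \<beta>)) \<and>
    (\<forall>B :: real ^ 'k ^ ('m + 's).
       columns_form_basis B
         {vstack y p | y p.
            p \<in> critical_cone (conjugate h) pbar (G (xbar, ybar) - \<alpha> *\<^sub>R pbar)} \<longrightarrow>
       (let A = matrix_A g G h \<alpha> \<beta> xbar ybar pbar;
            M = transpose B ** A ** B
        in invertible M \<and>
           jacobian (\<lambda>x. case sol_map g G h \<alpha> \<beta> x of (y, p) \<Rightarrow> vstack y p) (at xbar) =
             - (B ** matrix_inv M ** transpose B ** x_derivatives g G h \<alpha> \<beta> xbar ybar pbar)))"
proof -
  note conv = assms(3,4) and h = assms(5-7) and pos = assms(8,9) and ri = assms(11)
  have hE: "closed {(z, t). h z \<le> ereal t}" "convex {(z, t). h z \<le> ereal t}"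
    using h(2) polyhedron_imp_closed polyhedron_imp_convex by (auto simp: epi_polyhedral_def)
  obtain g' where g': "\<And>z. (g has_derivative blinfun_apply (g' z)) (at z)" "C1_on UNIV g'"
    using C2E[OF assms(1)] by metis
  obtain G' where G': "\<And>z. (G has_derivative blinfun_apply (G' z)) (at z)" "C1_on UNIV G'" "C1_on UNIV G"
    using C2E[OF assms(2)] by metis
  \<comment> \<open>Only with a solution at hand does the equation for \<open>(ybar, pbar)\<close>,
    a definite description, yield membership in the solution set.\<close>
  obtain s where s: "s \<in> sol_set g G h \<alpha> \<beta> xbar"
    using sol_set_nonempty[OF g'(1) G'(1) conv h(1) hE h(3) pos] by metis
  have sol: "(ybar, pbar) \<in> sol_set g G h \<alpha> \<beta> xbar"
    using sol_mapI[OF g'(1) G'(1) conv h(1) hE h(3) pos s] s assms(10) by simp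
  define K where "K = critical_cone (conjugate h) pbar (G (xbar, ybar) - \<alpha> *\<^sub>R pbar)"
  define V where "V = {vstack y p | (y :: real ^ 'm) p. p \<in> K}"
  obtain LD where LD: "\<And>z. ((\<lambda>(x, y, p). lagrangian_gradient g' G' \<beta> x y p) has_derivative LD z) (at z)"
    using C1_onE[OF C1_on_lagrangian_gradient[OF g'(2) G'(2)]] by (metis UNIV_I)
  define L' where "L' = LD (xbar, ybar, pbar)"
  have L': "((\<lambda>(x, y, p). lagrangian_gradient g' G' \<beta> x y p) has_derivative L') (at (xbar, ybar, pbar))"
    unfolding L'_def by (rule LD)
  obtain U S' where U: "open U" "xbar \<in> U" "C1_on U (sol_map g G h \<alpha> \<beta>)"
    and S': "(sol_map g G h \<alpha> \<beta> has_derivative S') (at xbar)"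
    and K: "\<And>d. snd (S' d) \<in> K" and res: "\<And>d. L' (d, S' d) = 0"
    "\<And>d. G' (xbar, ybar) (d, fst (S' d)) - \<alpha> *\<^sub>R snd (S' d) \<in> K\<^sup>\<bottom>"
    using sol_map_C1[OF g' G' conv h pos sol ri L'] unfolding K_def by metis
  have p0: "0 \<le> pbar $ i" for i
    using sol subdifferential_conjugateD[OF h(1) hE] subgradient_nonneg[OF h(1,3)]
    unfolding mem_sol_set_iff[OF g'(1) G'(1)] by blast
  have fin: "\<bar>conjugate h pbar\<bar> \<noteq> \<infinity>"
    using sol by (auto simp: mem_sol_set_iff[OF g'(1) G'(1)] subdifferential_def)
  note gradL = grad_y_lagrangian_eq[OF g'(1) G'(1) fin]
  note L'_partial = lagrangian_gradient_partial_derivatives[OF L']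
  note linL' = has_derivative_linear[OF L']
  let ?A = "matrix_A g G h \<alpha> \<beta> xbar ybar pbar"
  let ?X = "x_derivatives g G h \<alpha> \<beta> xbar ybar pbar"
  let ?S = "jacobian (\<lambda>x. case sol_map g G h \<alpha> \<beta> x of (y, p) \<Rightarrow> vstack y p) (at xbar)"
  have jac_mult: "jacobian f (at x) *v d = f' d" if "(f has_derivative f') (at x)"
    for f :: "real ^ 'a \<Rightarrow> real ^ 'b" and f' x d
    using jacobian_eqI[OF that] has_derivative_linear[OF that] by (simp add: matrix_works)
  \<comment> \<open>The matrix is the derivative in \<open>(y, p)\<close> of the Lagrangian gradient
    stacked over \<open>G (x, y) - \<alpha> p\<close>; \<open>?X\<close> below is the derivative of
    the same pair in \<open>x\<close>.\<close>
  have A: "?A *v vstack d q = vstack (L' (0, d, q)) (G' (xbar, ybar) (0, d) - \<alpha> *\<^sub>R q)" for d q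
  proof -
    have "L' (0, d, q) = L' (0, d, 0) + partial_adjoint (G' (xbar, ybar)) q"
      using linear_add[OF linL', of "(0, d, 0)" "(0, 0, q)"] L'_partial(3) by simp
    moreover have "(- (\<alpha> *\<^sub>R mat 1)) *v q = - (\<alpha> *\<^sub>R q)"
      using matrix_vector_mult_diff_rdistrib[of 0 "\<alpha> *\<^sub>R mat 1" q]
      by (simp add: scaleR_matrix_vector_assoc[symmetric])
    ultimately show ?thesis
      unfolding matrix_A_def Let_def gradL vstack_mult_vec hstack_mult_vstack
        jac_mult[OF L'_partial(2)] jac_mult[OF partial_derivative_right[OF G'(1)]]
        transpose_jacobian_mult[OF G'(1)]
      by simp
  qed
  have X: "?X *v d = vstack (L' (d, 0, 0)) (G' (xbar, ybar) (d, 0))" for d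
    unfolding x_derivatives_def gradL vstack_mult_vec
      jac_mult[OF L'_partial(1)] jac_mult[OF partial_derivative_left[OF G'(1)]] ..
  have S: "?S *v d = vstack (fst (S' d)) (snd (S' d))" for d
    using jac_mult[OF bounded_linear.has_derivative[OF bounded_linear_vstack S'], of d]
    by (simp add: case_prod_unfold)
  have subK: "0 \<in> K"
    using K[of 0] linear_0[OF has_derivative_linear[OF S']] by simp
  have "invertible (transpose B ** ?A ** B) \<and>
      ?S = - (B ** matrix_inv (transpose B ** ?A ** B) ** transpose B ** ?X)"
    if B: "columns_form_basis B V" for B :: "real ^ 'k ^ ('m + 's)"
  proof (rule reduced_linear_system[OF B])
    fix v assume "v \<in> V" and orth: "\<And>w. w \<in> V \<Longrightarrow> w \<bullet> (?A *v v) = 0"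
    then obtain d q where v: "v = vstack d q" "q \<in> K"
      by (auto simp: V_def)
    have orth': "e \<bullet> L' (0, d, q) + r \<bullet> (G' (xbar, ybar) (0, d) - \<alpha> *\<^sub>R q) = 0" if "r \<in> K" for e r
      using orth[of "vstack e r"] that by (auto simp: V_def v A vstack_inner)
    \<comment> \<open>The first block of a test vector is unrestricted, so this component can be
      tested against itself.\<close>
    have "L' (0, d, q) = 0"
      using orth'[OF subK, of "L' (0, d, q)"] by simp
    moreover have "G' (xbar, ybar) (0, d) - \<alpha> *\<^sub>R q \<in> K\<^sup>\<bottom>"
      using orth'[of _ 0] by (simp add: orthogonal_comp_def orthogonal_def)
    ultimately have "d = 0 \<and> q = 0"
      using v(2) by (intro reduced_system_injective[OF g'(1) G'(1) conv p0 pos L'])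
    then show "v = 0"
      by (simp add: v vstack_def vec_eq_iff split_sum_all)
  next
    fix d
    show "?S *v d \<in> V"
      using K by (auto simp: S V_def)
    fix w assume "w \<in> V"
    then obtain e r where w: "w = vstack e r" "r \<in> K"
      by (auto simp: V_def)
    \<comment> \<open>The first block of the residual vanishes outright; the second is only
      orthogonal to \<open>K\<close>, which suffices against \<open>r \<in> K\<close>.\<close>
    have "L' (d, 0, 0) + L' (0, S' d) = 0"
      using linear_add[OF linL', of "(d, 0, 0)" "(0, S' d)"] res(1)[of d] by (simp flip: zero_prod_def)
    moreover have "G' (xbar, ybar) (d, 0) + G' (xbar, ybar) (0, fst (S' d)) = G' (xbar, ybar) (d, fst (S' d))"
      using blinfun.add_right[of "G' (xbar, ybar)" "(d, 0)" "(0, fst (S' d))"] by simp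
    then have "r \<bullet> (G' (xbar, ybar) (d, 0) + (G' (xbar, ybar) (0, fst (S' d)) - \<alpha> *\<^sub>R snd (S' d))) = 0"
      using res(2)[of d] w(2) by (simp add: orthogonal_comp_def orthogonal_def algebra_simps)
    ultimately show "w \<bullet> (?X *v d + ?A *v (?S *v d)) = 0"
      by (simp add: S A X w(1) vstack_add vstack_inner)
  qed
  then show ?thesis
    using U unfolding Let_def V_def K_def by blast
qed

end
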